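(* Let $X_{\boldsymbol\tau}$ be the subshift generated by a recognizable and primitive directive sequence $\boldsymbol\tau = (\tau_n \colon \mathcal A_{n+1}^* \to \mathcal A_n^* )_{n \geq 0}$, and suppose that each $\tau_n$ is left-proper. Then a real number $\alpha$ is a continuous eigenvalue of $X_{\boldsymbol\tau}$ if and only if $$\sup\big\{ \| \alpha\, h_n(u) \| : u \in \mathcal L(X_{\boldsymbol\tau}^{(n)}) \big\}$$ converges to $0$ as $n \to \infty$. If $\boldsymbol\tau$ is additionally positive, then $\alpha$ is a continuous eigenvalue of $X_{\boldsymbol\tau}$ if and only if $$\sum_{n\geq0} \max\big\{ \| \alpha\, h_n(u) \| : a \in \mathcal A_{n+2},\ u \text{ a prefix of } \tau_n(\tau_{n+1}(a)) \big\} < \infty.$$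
   Context: Alphabets are finite sets with at least two elements. $\mathcal A^*$ is the free monoid of finite words over $\mathcal A$ and $|w|$ is the length of $w$. $S$ is the shift map $S((x_k)_k)=(x_{k+1})_k$ on $\mathcal A^{\mathbb Z}$; a subshift is a closed set $X\subseteq\mathcal A^{\mathbb Z}$ with $S(X)=X$; $\mathcal L(X)$ is the set of finite words occurring in points of $X$. A substitution $\tau:\mathcal A^*\to\mathcal B^*$ is a monoid morphism such that $\tau(a)$ is non-empty for every $a\in\mathcal A$ and every $b\in\mathcal B$ occurs in some $\tau(a)$; it acts on $x\in\mathcal A^{\mathbb Z}$ by concatenation, with $\tau(x_0)$ starting at coordinate $0$. It is left-proper if there is a single letter $b\in\mathcal B$ such that $\tau(a)$ starts with $b$ for every $a\in\mathcal A$. A directive sequence $\boldsymbol\tau=(\tau_n)_{n\ge0}$ consists of substitutions $\tau_n:\mathcal A_{n+1}^*\to\mathcal A_n^*$. Put $\tau_{n,m}=\tau_n\circ\cdots\circ\tau_{m-1}$ for $m>n$. $X^{(n)}_{\boldsymbol\tau}$ is the set of $x\in\mathcal A_n^{\mathbb Z}$ such that every finite factor of $x$ occurs in $\tau_{n,m}(a)$ for some $m>n$ and $a\in\mathcal A_m$; $X_{\boldsymbol\tau}=X^{(0)}_{\boldsymbol\tau}$ is the subshift generated by $\boldsymbol\tau$. Heights: $h_n(u)=|\tau_{0,n}(u)|$ for $u\in\mathcal A_n^*$, $n\ge1$, and $h_0(u)=|u|$. $\boldsymbol\tau$ is primitive if for every $n$ there is $m>n$ such that every letter of $\mathcal A_n$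 occurs in $\tau_{n,m}(a)$ for every $a\in\mathcal A_m$; it is positive if for every $n$ one can take $m=n+1$. $\boldsymbol\tau$ is recognizable if, for every $n\ge1$, the sets $S^kB_n(a)$ ($a\in\mathcal A_n$, $0\le k<h_n(a)$) are pairwise disjoint, where $B_n(a)=\{\tau_{0,n}(x):x\in X^{(n)}_{\boldsymbol\tau},\ x_0=a\}$. A real number $\alpha$ is a continuous (additive) eigenvalue of a subshift $X$ if there is a continuous $g:X\to\mathbb R/\mathbb Z$ with $g(Sx)=g(x)+\alpha \pmod{\mathbb Z}$ for all $x\in X$. For $x\in\mathbb R$, $\|x\|$ is the distance from $x$ to the nearest integer. *)

theory Defs
  imports "HOL-Analysis.Analysis" "HOL-Library.Sublist" "HOL-Library.Disjoint_Sets"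
begin

section \<open>The circle group\<close>

quotient_type circle = real / "\<lambda>x y :: real. x - y \<in> \<int>"
proof (intro equivpI reflpI sympI transpI)
  fix x y z :: real
  show "x - x \<in> \<int>" by simp
  show "y - x \<in> \<int>" if "x - y \<in> \<int>"
    using Ints_minus[OF that] by simp
  show "x - z \<in> \<int>" if "x - y \<in> \<int>" "y - z \<in> \<int>"
    using Ints_add[OF that] by simp
qed

lift_definition real_mod_Z :: "real \<Rightarrow> circle" is "\<lambda>x. x" .

instantiation circle :: ab_group_add
begin

lift_definition zero_circle :: circle is 0 .

lift_definition plus_circle :: "circle \<Rightarrow> circle \<Rightarrow> circle" is "(+)"
  by (metis Ints_add add_diff_add)

lift_definition minus_circle :: "circle \<Rightarrow> circle \<Rightarrow> circle" is "(-)"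
  by (metis Ints_diff diff_diff_eq2 diff_diff_eq add_diff_eq diff_add_eq add.commute)

lift_definition uminus_circle :: "circle \<Rightarrow> circle" is uminus
  by (metis Ints_minus minus_diff_minus)

instance
  by standard (transfer; simp)+

end

text \<open>The quotient topology of the real line.\<close>

instantiation circle :: topological_space
begin

definition open_circle :: "circle set \<Rightarrow> bool"
  where "open_circle U \<longleftrightarrow> open (real_mod_Z -` U)"

instance
  by standard (auto simp: open_circle_def vimage_Union)

end

definition dist_nearest_int :: "real \<Rightarrow> real"
  where "dist_nearest_int x = \<bar>x - of_int (round x)\<bar>"


section \<open>Subshifts and their continuous eigenvalues\<close>

definition shift_map :: "(int \<Rightarrow> 'a) \<Rightarrow> (int \<Rightarrow> 'a)"
  where "shift_map x = (\<lambda>k. x (k + 1))"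

definition factor :: "(int \<Rightarrow> 'a) \<Rightarrow> int \<Rightarrow> nat \<Rightarrow> 'a list"
  where "factor x i k = map (\<lambda>j. x (i + int j)) [0..<k]"

definition language :: "(int \<Rightarrow> 'a) set \<Rightarrow> 'a list set"
  where "language X = {factor x i k | x i k. x \<in> X}"

definition full_shift :: "'a set \<Rightarrow> (int \<Rightarrow> 'a) topology"
  where "full_shift A = product_topology (\<lambda>_. discrete_topology A) UNIV"

definition continuous_eigenvalue :: "'a set \<Rightarrow> (int \<Rightarrow> 'a) set \<Rightarrow> real \<Rightarrow> bool"
  where "continuous_eigenvalue A X \<alpha> \<longleftrightarrow>
    (\<exists>g :: (int \<Rightarrow> 'a) \<Rightarrow> circle.
        continuous_map (subtopology (full_shift A) X) euclidean g \<and>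
        (\<forall>x\<in>X. g (shift_map x) = g x + real_mod_Z \<alpha>))"


section \<open>Substitutions\<close>

definition alphabet :: "'a set \<Rightarrow> bool"
  where "alphabet A \<longleftrightarrow> finite A \<and> card A \<ge> 2"

definition substitution :: "'a set \<Rightarrow> 'b set \<Rightarrow> ('a list \<Rightarrow> 'b list) \<Rightarrow> bool"
  where "substitution A B \<sigma> \<longleftrightarrow>
    (\<forall>u\<in>lists A. \<sigma> u \<in> lists B) \<and>
    (\<forall>u\<in>lists A. \<forall>v\<in>lists A. \<sigma> (u @ v) = \<sigma> u @ \<sigma> v) \<and>
    (\<forall>a\<in>A. \<sigma> [a] \<noteq> []) \<and>
    (\<forall>b\<in>B. \<exists>a\<in>A. b \<in> set (\<sigma> [a]))"

definition left_proper :: "'a set \<Rightarrow> 'b set \<Rightarrow> ('a list \<Rightarrow> 'b list) \<Rightarrow> bool"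
  where "left_proper A B \<sigma> \<longleftrightarrow> (\<exists>b\<in>B. \<forall>a\<in>A. prefix [b] (\<sigma> [a]))"

text \<open>
  The action of a substitution on a bi-infinite word, the image of the letter at 0 starting at
  coordinate 0.  As letters have non-empty images, coordinate \<open>j \<ge> 0\<close> of the result lies within
  the image of \<open>x 0 \<dots> x j\<close>, which is laid out from coordinate 0 to the right, and coordinate
  \<open>j < 0\<close> lies within the image of \<open>x j \<dots> x (-1)\<close>, whose last letter is put at coordinate
  \<open>-1\<close>.
\<close>

definition subst_point :: "('a list \<Rightarrow> 'b list) \<Rightarrow> (int \<Rightarrow> 'a) \<Rightarrow> (int \<Rightarrow> 'b)"
  where "subst_point \<sigma> x = (\<lambda>j.
    if j \<ge> 0 then \<sigma> (factor x 0 (nat j + 1)) ! nat j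
    else rev (\<sigma> (factor x j (nat (- j)))) ! (nat (- j) - 1))"


section \<open>Directive sequences\<close>

definition directive_sequence :: "(nat \<Rightarrow> 'a set) \<Rightarrow> (nat \<Rightarrow> 'a list \<Rightarrow> 'a list) \<Rightarrow> bool"
  where "directive_sequence A \<tau> \<longleftrightarrow>
    (\<forall>n. alphabet (A n)) \<and> (\<forall>n. substitution (A (Suc n)) (A n) (\<tau> n))"

text \<open>The composition \<open>\<tau> n \<circ> \<dots> \<circ> \<tau> (m - 1)\<close>; it is the identity for \<open>m = n\<close>.\<close>

definition subst_comp :: "(nat \<Rightarrow> 'a list \<Rightarrow> 'a list) \<Rightarrow> nat \<Rightarrow> nat \<Rightarrow> 'a list \<Rightarrow> 'a list"
  where "subst_comp \<tau> n m = foldr (\<circ>) (map \<tau> [n..<m]) id"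

definition level_subshift ::
    "(nat \<Rightarrow> 'a set) \<Rightarrow> (nat \<Rightarrow> 'a list \<Rightarrow> 'a list) \<Rightarrow> nat \<Rightarrow> (int \<Rightarrow> 'a) set"
  where "level_subshift A \<tau> n =
    {x. range x \<subseteq> A n \<and>
        (\<forall>i k. \<exists>m>n. \<exists>a\<in>A m. sublist (factor x i k) (subst_comp \<tau> n m [a]))}"

definition height :: "(nat \<Rightarrow> 'a list \<Rightarrow> 'a list) \<Rightarrow> nat \<Rightarrow> 'a list \<Rightarrow> nat"
  where "height \<tau> n u = length (subst_comp \<tau> 0 n u)"

definition primitive_sequence :: "(nat \<Rightarrow> 'a set) \<Rightarrow> (nat \<Rightarrow> 'a list \<Rightarrow> 'a list) \<Rightarrow> bool"
  where "primitive_sequence A \<tau> \<longleftrightarrow>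
    (\<forall>n. \<exists>m>n. \<forall>a\<in>A m. \<forall>b\<in>A n. b \<in> set (subst_comp \<tau> n m [a]))"

definition positive_sequence :: "(nat \<Rightarrow> 'a set) \<Rightarrow> (nat \<Rightarrow> 'a list \<Rightarrow> 'a list) \<Rightarrow> bool"
  where "positive_sequence A \<tau> \<longleftrightarrow>
    (\<forall>n. \<forall>a\<in>A (n + 1). \<forall>b\<in>A n. b \<in> set (subst_comp \<tau> n (n + 1) [a]))"

definition tower_base ::
    "(nat \<Rightarrow> 'a set) \<Rightarrow> (nat \<Rightarrow> 'a list \<Rightarrow> 'a list) \<Rightarrow> nat \<Rightarrow> 'a \<Rightarrow> (int \<Rightarrow> 'a) set"
  where "tower_base A \<tau> n a =
    {subst_point (subst_comp \<tau> 0 n) x | x. x \<in> level_subshift A \<tau> n \<and> x 0 = a}"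

definition recognizable :: "(nat \<Rightarrow> 'a set) \<Rightarrow> (nat \<Rightarrow> 'a list \<Rightarrow> 'a list) \<Rightarrow> bool"
  where "recognizable A \<tau> \<longleftrightarrow>
    (\<forall>n\<ge>1. disjoint_family_on (\<lambda>(a, k). (shift_map ^^ k) ` tower_base A \<tau> n a)
       {(a, k). a \<in> A n \<and> k < height \<tau> n [a]})"

end

theory Submission
  imports Defs
begin

text \<open>
  Write \<open>X\<^sub>n\<close> for the subshift of level \<open>n\<close>. A point of \<open>X\<^sub>0\<close> is cut, at every level \<open>n\<close>, into images of
  letters of level \<open>n\<close>: it lies at some floor of one of finitely many towers, over the letters, whose
  heights are the heights of the letters. The cutting exists by compactness and is unique by
  recognizability, hence locally constant. The floor number, called the entry time below, increases by
  \<open>1\<close> under the shift until the top of a tower is left.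

  If all heights of words of level \<open>n\<close> are nearly integers after multiplication by \<open>\<alpha>\<close>, then \<open>\<alpha>\<close> times the
  entry time is nearly an eigenfunction. Entry times at two levels differ by the height of a word
  (\<open>entry_time_refine\<close>), so these approximate eigenfunctions converge uniformly and the limit is a continuous
  one. Conversely, left-properness makes the images of all letters of a high level start with the
  same long word. A continuous eigenfunction then takes nearly the same value at the beginnings of
  any two blocks. The time between these is the height of the word read in between, so \<open>\<alpha>\<close> times
  this height is nearly an integer. Only the right halves of the two points are known to
  agree, but both can be shifted by half of the length of the common word, and this leaves the difference
  of the values unchanged.

  For the series, a proper prefix of the image of a letter of a high level is composed of one prefix of the
  image of a letter for each level in between. So the heights at level \<open>n\<close> are controlled by
  a tail of the series (\<open>dist_prefix_image_le_sum\<close>). In the other direction, suppose that the heights become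
  nearly integers. Left-properness yields a distinguished letter at each level, with which all images
  of letters begin. Positivity relates the prefix with the maximal distance to proper prefixes of the image
  of such a distinguished letter, and proper prefixes chosen at levels that are five apart can be stacked
  independently of each other (\<open>stack_prefixes\<close>). Every subset sum of their heights is again the height of
  a word, hence nearly an integer after multiplication by \<open>\<alpha>\<close>. Real numbers all of whose subset sums are
  close to integers have a bounded sum of distances to the integers
  (\<open>sum_dist_le_if_subset_sums_near_int\<close>), which is the summability.
\<close>

section \<open>Distance to the integers and the circle\<close>

lemma dist_nearest_int_le_diff: "dist_nearest_int x \<le> \<bar>x - of_int m\<bar>"
  unfolding dist_nearest_int_def by (rule round_diff_minimal)

lemma dist_nearest_int_nonneg [simp]: "0 \<le> dist_nearest_int x"
  by (simp add: dist_nearest_int_def)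

lemma dist_nearest_int_le_half: "dist_nearest_int x \<le> 1 / 2"
  using of_int_round_abs_le[of x] by (simp add: dist_nearest_int_def abs_minus_commute)

lemma dist_nearest_int_le_abs: "dist_nearest_int x \<le> \<bar>x\<bar>"
  using dist_nearest_int_le_diff[of x 0] by simp

lemma dist_nearest_int_0 [simp]: "dist_nearest_int 0 = 0"
  by (simp add: dist_nearest_int_def)

lemma dist_nearest_int_add: "dist_nearest_int (x + y) \<le> dist_nearest_int x + dist_nearest_int y"
proof -
  have "dist_nearest_int (x + y) \<le> \<bar>x + y - of_int (round x + round y)\<bar>"
    by (rule dist_nearest_int_le_diff)
  also have "\<dots> \<le> dist_nearest_int x + dist_nearest_int y"
    unfolding dist_nearest_int_def by simp
  finally show ?thesis .
qed

lemma dist_nearest_int_minus [simp]: "dist_nearest_int (- x) = dist_nearest_int x"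
proof -
  have le: "dist_nearest_int (- y) \<le> dist_nearest_int y" for y
    using dist_nearest_int_le_diff[of "- y" "- round y"] by (simp add: dist_nearest_int_def)
  show ?thesis using le[of x] le[of "- x"] by simp
qed

lemma dist_nearest_int_diff: "dist_nearest_int (x - y) \<le> dist_nearest_int x + dist_nearest_int y"
  using dist_nearest_int_add[of x "- y"] by simp

lemma dist_nearest_int_commute: "dist_nearest_int (x - y) = dist_nearest_int (y - x)"
  using dist_nearest_int_minus[of "x - y"] by simp

lemma dist_nearest_int_triangle:
  "dist_nearest_int (x - z) \<le> dist_nearest_int (x - y) + dist_nearest_int (y - z)"
  using dist_nearest_int_add[of "x - y" "y - z"] by simp

lemma dist_nearest_int_cong_Ints:
  assumes "x - y \<in> \<int>"
  shows "dist_nearest_int x = dist_nearest_int y"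
proof -
  have le: "dist_nearest_int x \<le> dist_nearest_int y" if "x - y \<in> \<int>" for x y
  proof -
    obtain k where k: "x - y = of_int k" using \<open>x - y \<in> \<int>\<close> by (elim Ints_cases)
    show ?thesis
      using dist_nearest_int_le_diff[of x "round y + k"] k
      by (simp add: dist_nearest_int_def algebra_simps)
  qed
  have "y - x \<in> \<int>" using Ints_minus[OF assms] by simp
  then show ?thesis using le assms by (simp add: order_antisym)
qed

lemma dist_nearest_int_eq_0_iff: "dist_nearest_int x = 0 \<longleftrightarrow> x \<in> \<int>"
proof
  assume "dist_nearest_int x = 0"
  then have "x = of_int (round x)" by (simp add: dist_nearest_int_def)
  then show "x \<in> \<int>" by (metis Ints_of_int)
next
  assume "x \<in> \<int>"
  then show "dist_nearest_int x = 0" by (elim Ints_cases) (simp add: dist_nearest_int_def)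
qed

lemma continuous_on_dist_nearest_int: "continuous_on S dist_nearest_int"
proof (rule continuous_onI)
  fix x e :: real assume e: "e > 0"
  have "dist (dist_nearest_int x') (dist_nearest_int x) \<le> e" if "dist x' x < e" for x'
    using dist_nearest_int_diff[of x' "x' - x"] dist_nearest_int_diff[of x "x - x'"]
      dist_nearest_int_le_abs[of "x - x'"] dist_nearest_int_commute[of x x'] that
    by (simp add: dist_real_def abs_if split: if_splits)
  with e show "\<exists>d>0. \<forall>x'\<in>S. dist x' x < d \<longrightarrow> dist (dist_nearest_int x') (dist_nearest_int x) \<le> e"
    by blast
qed

lift_definition circle_norm :: "circle \<Rightarrow> real" is dist_nearest_int
  by (rule dist_nearest_int_cong_Ints)

lemma circle_norm_real_mod_Z [simp]: "circle_norm (real_mod_Z x) = dist_nearest_int x"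
  by transfer simp

lemma real_mod_Z_add: "real_mod_Z (x + y) = real_mod_Z x + real_mod_Z y"
  by transfer simp

lemma real_mod_Z_diff: "real_mod_Z (x - y) = real_mod_Z x - real_mod_Z y"
  by transfer simp

lemma circle_norm_0 [simp]: "circle_norm 0 = 0"
  by transfer simp

lemma real_mod_Z_eq_iff: "real_mod_Z x = real_mod_Z y \<longleftrightarrow> x - y \<in> \<int>"
  by transfer simp

lemma surj_real_mod_Z: "\<exists>x. c = real_mod_Z x"
  by transfer (metis diff_self Ints_0)

lemma circle_norm_triangle: "circle_norm (p - r) \<le> circle_norm (p - q) + circle_norm (q - r)"
  by transfer (rule dist_nearest_int_triangle)

lemma circle_norm_commute: "circle_norm (p - q) = circle_norm (q - p)"
  by transfer (rule dist_nearest_int_commute)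

text \<open>The norm induces the quotient topology: each ball pulls back to an open set of reals by
  continuity of the distance to the integers, and the norm of a class is at most the absolute
  value of any representative.\<close>

lemma open_circle_ball: "open {q. circle_norm (q - p) < e}"
proof -
  obtain s where s: "p = real_mod_Z s" using surj_real_mod_Z by blast
  have "real_mod_Z -` {q. circle_norm (q - p) < e} = {t. dist_nearest_int (t - s) < e}"
    by (auto simp: s simp flip: real_mod_Z_diff)
  moreover have "open {t. dist_nearest_int (t - s) < e}"
    by (intro open_Collect_less continuous_intros
        continuous_on_compose2[OF continuous_on_dist_nearest_int[of UNIV], of UNIV "\<lambda>t. t - s"])
      auto
  ultimately show ?thesis by (simp add: open_circle_def)
qed

lemma open_circle_contains_ball:
  assumes "open U" "p \<in> U"
  shows "\<exists>e>0. \<forall>q. circle_norm (q - p) < e \<longrightarrow> q \<in> U"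
proof -
  obtain s where s: "p = real_mod_Z s" using surj_real_mod_Z by blast
  have "open (real_mod_Z -` U)" "s \<in> real_mod_Z -` U"
    using assms s by (auto simp: open_circle_def)
  then obtain e where e: "e > 0" "\<And>t. dist t s < e \<Longrightarrow> real_mod_Z t \<in> U"
    unfolding open_dist by blast
  have "q \<in> U" if q: "circle_norm (q - p) < e" for q
  proof -
    obtain t where t: "q = real_mod_Z t" using surj_real_mod_Z by blast
    define t' where "t' = t - of_int (round (t - s))"
    have "real_mod_Z t' = q" by (simp add: t t'_def real_mod_Z_eq_iff)
    moreover have "dist t' s < e"
      using q unfolding s t real_mod_Z_diff[symmetric] circle_norm_real_mod_Z
      by (simp add: dist_nearest_int_def t'_def dist_real_def algebra_simps)
    ultimately show ?thesis using e(2) by metis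
  qed
  with e(1) show ?thesis by blast
qed


section \<open>Windows and compactness of the full shift\<close>

definition agree :: "nat \<Rightarrow> (int \<Rightarrow> 'a) \<Rightarrow> (int \<Rightarrow> 'a) \<Rightarrow> bool"
  where "agree N x y \<longleftrightarrow> (\<forall>i. \<bar>i\<bar> \<le> int N \<longrightarrow> x i = y i)"

lemma agree_refl [simp]: "agree N x x"
  by (simp add: agree_def)

lemma agree_sym: "agree N x y \<Longrightarrow> agree N y x"
  by (simp add: agree_def)

lemma agree_trans: "agree N x y \<Longrightarrow> agree N y z \<Longrightarrow> agree N x z"
  by (simp add: agree_def)

lemma agree_mono: "agree N x y \<Longrightarrow> M \<le> N \<Longrightarrow> agree M x y"
  unfolding agree_def by (meson of_nat_le_iff order_trans)

lemma factor_cong_agree: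
  assumes "agree N x y" "- int N \<le> i" "i + int k \<le> int N + 1"
  shows "factor x i k = factor y i k"
  using assms unfolding factor_def agree_def by (auto intro!: map_cong)

lemma topspace_full_shift [simp]: "topspace (full_shift A) = {x. range x \<subseteq> A}"
  by (auto simp: full_shift_def topspace_product_topology PiE_UNIV_domain)

lemma openin_full_shift_cylinder:
  "openin (full_shift A) {y. range y \<subseteq> A \<and> agree N y x}"
proof -
  define U where "U i = (if \<bar>i\<bar> \<le> int N then {x i} \<inter> A else A)" for i
  have "{i. \<bar>i\<bar> \<le> int N} = {- int N..int N}" by auto
  then have fin: "finite {i. \<bar>i\<bar> \<le> int N}" by simp
  have "{i \<in> UNIV. U i \<noteq> topspace (discrete_topology A)} \<subseteq> {i. \<bar>i\<bar> \<le> int N}"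
    by (auto simp: U_def)
  from finite_subset[OF this fin] have "openin (full_shift A) (Pi\<^sub>E UNIV U)"
    unfolding full_shift_def by (subst openin_PiE_gen) (auto simp: U_def)
  also have "Pi\<^sub>E UNIV U = {y. range y \<subseteq> A \<and> agree N y x}"
  proof (intro set_eqI iffI)
    fix y assume "y \<in> Pi\<^sub>E UNIV U"
    then have U: "y i \<in> U i" for i by auto
    have "y i \<in> A" for i using U[of i] by (auto simp: U_def split: if_splits)
    moreover have "y i = x i" if "\<bar>i\<bar> \<le> int N" for i using U[of i] that by (simp add: U_def)
    ultimately show "y \<in> {y. range y \<subseteq> A \<and> agree N y x}" by (auto simp: agree_def)
  next
    fix y assume y: "y \<in> {y. range y \<subseteq> A \<and> agree N y x}"
    then have "y i \<in> A" "\<bar>i\<bar> \<le> int N \<Longrightarrow> y i = x i" for i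
      by (auto simp: agree_def)
    then have "y i \<in> U i" for i by (metis IntI U_def insertI1)
    then show "y \<in> Pi\<^sub>E UNIV U" by (simp add: PiE_UNIV_domain)
  qed
  finally show ?thesis .
qed

lemma openin_full_shift_contains_cylinder:
  assumes "openin (full_shift A) T" "x \<in> T"
  shows "\<exists>N. \<forall>y. range y \<subseteq> A \<and> agree N y x \<longrightarrow> y \<in> T"
proof -
  obtain U where U: "finite {i. U i \<noteq> A}" "\<forall>i. openin (discrete_topology A) (U i)"
      "x \<in> Pi\<^sub>E UNIV U" "Pi\<^sub>E UNIV U \<subseteq> T"
    using assms unfolding full_shift_def openin_product_topology_alt by force
  define N where "N = Max (insert 0 ((nat \<circ> abs) ` {i. U i \<noteq> A}))"
  have "y \<in> T" if "range y \<subseteq> A" "agree N y x" for y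
  proof -
    have "y i \<in> U i" for i
    proof (cases "U i = A")
      case True
      then show ?thesis using that(1) by auto
    next
      case False
      then have "nat \<bar>i\<bar> \<le> N" unfolding N_def using U(1) by (intro Max_ge) auto
      then have "y i = x i" using that(2) by (simp add: agree_def)
      then show ?thesis using U(3) by auto
    qed
    then show ?thesis using U(4) by auto
  qed
  then show ?thesis by blast
qed

text \<open>The form in which compactness of the full shift is used throughout: a decreasing sequence of
  conditions, each of which concerns only finitely many coordinates and can be met, can be met
  by one point.\<close>

lemma full_shift_compactness:
  assumes fin: "finite A"
    and dec: "\<And>N y. range y \<subseteq> A \<Longrightarrow> Q (Suc N) y \<Longrightarrow> Q N y"
    and loc: "\<And>N y y'. range y \<subseteq> A \<Longrightarrow> range y' \<subseteq> A \<Longrightarrow> agree (b N) y y' \<Longrightarrow> Q N y \<Longrightarrow> Q N y'"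
    and ex: "\<And>N. \<exists>y. range y \<subseteq> A \<and> Q N y"
  shows "\<exists>y. range y \<subseteq> A \<and> (\<forall>N. Q N y)"
proof -
  define C where "C N = {y. range y \<subseteq> A \<and> Q N y}" for N
  have closed: "closedin (full_shift A) (C N)" for N
  proof -
    have "\<exists>T. openin (full_shift A) T \<and> x \<in> T \<and> T \<subseteq> {y. range y \<subseteq> A} - C N"
      if x: "x \<in> {y. range y \<subseteq> A} - C N" for x
    proof (intro exI[of _ "{y. range y \<subseteq> A \<and> agree (b N) y x}"] conjI openin_full_shift_cylinder)
      show "{y. range y \<subseteq> A \<and> agree (b N) y x} \<subseteq> {y. range y \<subseteq> A} - C N"
        using x loc by (auto simp: C_def)
    qed (use x in auto)
    then have "openin (full_shift A) ({y. range y \<subseteq> A} - C N)"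
      by (subst openin_subopen) blast
    then show ?thesis by (auto simp: closedin_def C_def)
  qed
  have "compact_space (full_shift A)"
    unfolding full_shift_def using fin by (simp add: compact_space_product_topology compact_space_discrete_topology)
  moreover have "C N \<noteq> {}" for N using ex[of N] by (auto simp: C_def)
  moreover have "decseq C"
    by (rule decseq_SucI) (use dec in \<open>auto simp: C_def\<close>)
  ultimately have "(\<Inter>N. C N) \<noteq> {}"
    using closed by (intro compact_space_imp_nest[of "full_shift A"]) auto
  then show ?thesis by (auto simp: C_def)
qed

lemma continuous_map_circle_iff:
  fixes g :: "(int \<Rightarrow> 'a) \<Rightarrow> circle"
  assumes X: "\<And>x. x \<in> X \<Longrightarrow> range x \<subseteq> A"
  shows "continuous_map (subtopology (full_shift A) X) euclidean g \<longleftrightarrow>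
    (\<forall>x\<in>X. \<forall>e>0. \<exists>N. \<forall>y\<in>X. agree N y x \<longrightarrow> circle_norm (g y - g x) < e)" (is "?L \<longleftrightarrow> ?R")
proof -
  have top: "topspace (subtopology (full_shift A) X) = X"
    using X by auto
  show ?thesis
  proof
    assume L: ?L
    show ?R
    proof (intro ballI allI impI)
      fix x and e :: real assume x: "x \<in> X" and e: "e > 0"
      have "openin (subtopology (full_shift A) X)
          {y \<in> topspace (subtopology (full_shift A) X). g y \<in> {q. circle_norm (q - g x) < e}}"
        using L by (rule openin_continuous_map_preimage)
          (simp only: open_openin[symmetric] open_circle_ball)
      then obtain T where T: "openin (full_shift A) T"
          "{y \<in> X. circle_norm (g y - g x) < e} = T \<inter> X"
        unfolding openin_subtopology top by auto
      have "x \<in> T \<inter> X" unfolding T(2)[symmetric] using x e by simp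
      then have "x \<in> T" by blast
      from openin_full_shift_contains_cylinder[OF T(1) this]
      obtain N where N: "\<And>y. range y \<subseteq> A \<Longrightarrow> agree N y x \<Longrightarrow> y \<in> T" by blast
      then show "\<exists>N. \<forall>y\<in>X. agree N y x \<longrightarrow> circle_norm (g y - g x) < e"
        using T(2) X by (metis (mono_tags, lifting) IntI mem_Collect_eq)
    qed
  next
    assume R: ?R
    have "openin (subtopology (full_shift A) X) {y \<in> X. g y \<in> U}" if U: "open U" for U
    proof (subst openin_subopen, intro ballI)
      fix x assume x: "x \<in> {y \<in> X. g y \<in> U}"
      obtain e where e: "e > 0" "\<And>q. circle_norm (q - g x) < e \<Longrightarrow> q \<in> U"
        using open_circle_contains_ball[OF U, of "g x"] x by auto
      then obtain N where N: "\<And>y. y \<in> X \<Longrightarrow> agree N y x \<Longrightarrow> circle_norm (g y - g x) < e"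
        using R x by blast
      show "\<exists>T. openin (subtopology (full_shift A) X) T \<and> x \<in> T \<and> T \<subseteq> {y \<in> X. g y \<in> U}"
      proof (intro exI[of _ "{y. range y \<subseteq> A \<and> agree N y x} \<inter> X"] conjI)
        show "openin (subtopology (full_shift A) X) ({y. range y \<subseteq> A \<and> agree N y x} \<inter> X)"
          by (intro openin_subtopology_Int openin_full_shift_cylinder)
      qed (use x X N e in auto)
    qed
    then show ?L
      unfolding continuous_map_def top open_openin[symmetric] by auto
  qed
qed

text \<open>Heine--Cantor for functions to the circle. Were it false at some distance, then by compactness the
  pairs of points that violate it would accumulate at one point, where continuity fails.\<close>

lemma circle_valued_uniform_continuity:
  fixes g :: "(int \<Rightarrow> 'a) \<Rightarrow> circle"
  assumes fin: "finite A" and X: "\<And>x. x \<in> X \<Longrightarrow> range x \<subseteq> A"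
    and closed: "\<And>x. (\<And>N. \<exists>y\<in>X. agree N y x) \<Longrightarrow> x \<in> X"
    and cont: "continuous_map (subtopology (full_shift A) X) euclidean g" and e: "e > 0"
  shows "\<exists>N. \<forall>x\<in>X. \<forall>y\<in>X. agree N x y \<longrightarrow> circle_norm (g x - g y) < e"
proof (rule ccontr)
  assume neg: "\<not> ?thesis"
  define Q where "Q N z \<longleftrightarrow> (\<exists>M\<ge>N. \<exists>x\<in>X. \<exists>y\<in>X. agree M x y \<and> \<not> circle_norm (g x - g y) < e
      \<and> agree N x z)" for N z
  have "\<exists>z. range z \<subseteq> A \<and> (\<forall>N. Q N z)"
  proof (rule full_shift_compactness[where b = "\<lambda>N. N"])
    show "Q N y" if "Q (Suc N) y" for N y
      using that unfolding Q_def by (meson Suc_leD agree_mono le_SucI order_refl)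
    show "Q N y'" if "agree N y y'" "Q N y" for N y y'
      using that unfolding Q_def by (meson agree_trans)
    show "\<exists>y. range y \<subseteq> A \<and> Q N y" for N
      using neg X unfolding Q_def by (meson agree_refl order_refl)
  qed (rule fin)
  then obtain z where z: "range z \<subseteq> A" "\<And>N. Q N z" by blast
  have zX: "z \<in> X" using z(2) unfolding Q_def by (intro closed) blast
  then obtain N where N: "\<And>y. y \<in> X \<Longrightarrow> agree N y z \<Longrightarrow> circle_norm (g y - g z) < e / 2"
    using cont e continuous_map_circle_iff[OF X] by (metis half_gt_zero)
  obtain M x y where xy: "M \<ge> N" "x \<in> X" "y \<in> X" "agree M x y"
      "\<not> circle_norm (g x - g y) < e" "agree N x z"
    using z(2)[of N] unfolding Q_def by blast
  have "agree N y z" using xy by (meson agree_mono agree_sym agree_trans)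
  then have "circle_norm (g x - g z) < e / 2" "circle_norm (g z - g y) < e / 2"
    using N[OF xy(2) xy(6)] N[OF xy(3)] circle_norm_commute[of "g z" "g y"] by simp_all
  then show False
    using circle_norm_triangle[of "g x" "g y" "g z"] xy(5) by linarith
qed


section \<open>Substitutions acting on words and on points\<close>

lemma length_factor [simp]: "length (factor x i k) = k"
  by (simp add: factor_def)

lemma nth_factor [simp]: "j < k \<Longrightarrow> factor x i k ! j = x (i + int j)"
  by (simp add: factor_def)

lemma factor_0 [simp]: "factor x i 0 = []"
  by (simp add: factor_def)

lemma factor_eqI: "length w = k \<Longrightarrow> (\<And>j. j < k \<Longrightarrow> x (i + int j) = w ! j) \<Longrightarrow> factor x i k = w"
  by (rule nth_equalityI) auto

lemma factor_add: "factor x i (k + l) = factor x i k @ factor x (i + int k) l"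
  by (rule nth_equalityI) (auto simp: nth_append algebra_simps)

lemma factor_1 [simp]: "factor x i (Suc 0) = [x i]"
  by (simp add: factor_def)

lemma factor_in_lists: "range x \<subseteq> A \<Longrightarrow> factor x i k \<in> lists A"
  by (auto simp: factor_def image_subset_iff)

lemma factor_translate: "factor (\<lambda>j. x (j + c)) i k = factor x (i + c) k"
  by (simp add: factor_def algebra_simps)

lemma sublist_factor:
  assumes "i \<le> i'" "i' + int k' \<le> i + int k"
  shows "sublist (factor x i' k') (factor x i k)"
proof -
  define a where "a = nat (i' - i)"
  define b where "b = k - a - k'"
  have k: "k = a + (k' + b)" and i': "i' = i + int a" using assms by (auto simp: a_def b_def)
  show ?thesis unfolding k factor_add i' by (metis sublist_appendI)
qed

lemma shift_map_funpow: "(shift_map ^^ k) x = (\<lambda>j. x (j + int k))"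
  by (induction k arbitrary: x) (auto simp: shift_map_def algebra_simps)

lemma substitution_lists: "substitution A B \<sigma> \<Longrightarrow> u \<in> lists A \<Longrightarrow> \<sigma> u \<in> lists B"
  by (simp add: substitution_def)

lemma substitution_append:
  "substitution A B \<sigma> \<Longrightarrow> u \<in> lists A \<Longrightarrow> v \<in> lists A \<Longrightarrow> \<sigma> (u @ v) = \<sigma> u @ \<sigma> v"
  by (simp add: substitution_def)

lemma substitution_Nil: "substitution A B \<sigma> \<Longrightarrow> \<sigma> [] = []"
  using substitution_append[of A B \<sigma> "[]" "[]"] by simp

lemma substitution_Cons:
  "substitution A B \<sigma> \<Longrightarrow> a \<in> A \<Longrightarrow> v \<in> lists A \<Longrightarrow> \<sigma> (a # v) = \<sigma> [a] @ \<sigma> v"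
  using substitution_append[of A B \<sigma> "[a]" v] by simp

lemma substitution_letter_nonempty: "substitution A B \<sigma> \<Longrightarrow> a \<in> A \<Longrightarrow> \<sigma> [a] \<noteq> []"
  by (simp add: substitution_def)

lemma substitution_length_ge:
  assumes "substitution A B \<sigma>" "u \<in> lists A"
  shows "length u \<le> length (\<sigma> u)"
  using assms(2)
proof (induction u)
  case (Cons a u)
  then have "length (\<sigma> [a]) \<ge> 1"
    using substitution_letter_nonempty[OF assms(1), of a] by (cases "\<sigma> [a]") auto
  then show ?case using Cons substitution_Cons[OF assms(1), of a u] by simp
qed simp

lemma substitution_prefix:
  assumes "substitution A B \<sigma>" "prefix u v" "v \<in> lists A"
  shows "prefix (\<sigma> u) (\<sigma> v)"
proof -
  obtain r where "v = u @ r" using assms(2) by (rule prefixE)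
  with assms(3) have "\<sigma> v = \<sigma> u @ \<sigma> r"
    using substitution_append[OF assms(1), of u r] by simp
  then show ?thesis by simp
qed

lemma substitution_sublist:
  assumes "substitution A B \<sigma>" "sublist u v" "v \<in> lists A"
  shows "sublist (\<sigma> u) (\<sigma> v)"
proof -
  obtain l r where "v = l @ u @ r" using assms(2) by (auto simp: sublist_def)
  with assms(3) have "\<sigma> v = \<sigma> l @ \<sigma> u @ \<sigma> r"
    using substitution_append[OF assms(1), of l "u @ r"] substitution_append[OF assms(1), of u r]
    by simp
  then show ?thesis by simp
qed

lemma sublist_in_lists: "sublist u v \<Longrightarrow> v \<in> lists A \<Longrightarrow> u \<in> lists A"
  by (auto simp: sublist_def)

lemma prefix_in_lists: "prefix u v \<Longrightarrow> v \<in> lists A \<Longrightarrow> u \<in> lists A"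
  by (auto elim!: prefixE)

lemma substitution_factor_add:
  assumes "substitution A B \<sigma>" "range y \<subseteq> A"
  shows "\<sigma> (factor y i (k + l)) = \<sigma> (factor y i k) @ \<sigma> (factor y (i + int k) l)"
  unfolding factor_add
  by (rule substitution_append[OF assms(1)]) (rule factor_in_lists[OF assms(2)])+

lemma substitution_factor_Suc:
  assumes "substitution A B \<sigma>" "range y \<subseteq> A"
  shows "\<sigma> (factor y i (Suc l)) = \<sigma> [y i] @ \<sigma> (factor y (i + 1) l)"
  using substitution_factor_add[OF assms, of i 1 l] by simp

text \<open>The image of the letter at \<open>i\<close> occupies the coordinates from \<open>block_start \<sigma> y i\<close> up to, but excluding,
  \<open>block_start \<sigma> y (i + 1)\<close> in the image of \<open>y\<close>.\<close>

definition block_start :: "('a list \<Rightarrow> 'b list) \<Rightarrow> (int \<Rightarrow> 'a) \<Rightarrow> int \<Rightarrow> int"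
  where "block_start \<sigma> y i = (if i \<ge> 0 then int (length (\<sigma> (factor y 0 (nat i))))
    else - int (length (\<sigma> (factor y i (nat (- i))))))"

lemma block_start_0: "substitution A B \<sigma> \<Longrightarrow> block_start \<sigma> y 0 = 0"
  by (simp add: block_start_def substitution_Nil)

lemma block_start_nonpos: "substitution A B \<sigma> \<Longrightarrow> i \<le> 0 \<Longrightarrow> block_start \<sigma> y i \<le> 0"
  by (cases "i = 0") (auto simp: block_start_0, simp add: block_start_def)

lemma block_start_Suc:
  assumes s: "substitution A B \<sigma>" and y: "range y \<subseteq> A"
  shows "block_start \<sigma> y (i + 1) = block_start \<sigma> y i + int (length (\<sigma> [y i]))"
proof -
  consider "i \<ge> 0" | "i = -1" | "i < -1" by linarith
  then show ?thesis
  proof cases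
    case 1
    then have "nat (i + 1) = nat i + 1" by simp
    then show ?thesis
      using 1 substitution_factor_add[OF s y, of 0 "nat i" 1] by (simp add: block_start_def)
  next
    case 2
    then show ?thesis by (simp add: block_start_def substitution_Nil[OF s])
  next
    case 3
    then have "nat (- i) = Suc (nat (- (i + 1)))" by simp
    then have "\<sigma> (factor y i (nat (- i))) = \<sigma> [y i] @ \<sigma> (factor y (i + 1) (nat (- (i + 1))))"
      by (simp only: substitution_factor_Suc[OF s y])
    then show ?thesis using 3 by (simp add: block_start_def)
  qed
qed

lemma block_start_less_Suc:
  assumes "substitution A B \<sigma>" "range y \<subseteq> A"
  shows "block_start \<sigma> y i < block_start \<sigma> y (i + 1)"
  using block_start_Suc[OF assms] substitution_letter_nonempty[OF assms(1), of "y i"] assms(2) by auto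

lemma block_start_add:
  assumes s: "substitution A B \<sigma>" and y: "range y \<subseteq> A"
  shows "block_start \<sigma> y (i + int l) = block_start \<sigma> y i + int (length (\<sigma> (factor y i l)))"
proof (induction l arbitrary: i)
  case 0
  then show ?case by (simp add: substitution_Nil[OF s])
next
  case (Suc l)
  then show ?case
    using Suc[of "i + 1"] block_start_Suc[OF s y, of i]
    by (simp add: substitution_factor_Suc[OF s y] algebra_simps)
qed

lemma increasing_int_sequence_covers:
  fixes f :: "int \<Rightarrow> int"
  assumes f: "\<And>i. f i < f (i + 1)"
  shows "\<exists>i. f i \<le> j \<and> j < f (i + 1)"
proof -
  have grow: "f i + int n \<le> f (i + int n)" for i n
  proof (induction n)
    case (Suc n)
    then show ?case using f[of "i + int n"] by (simp add: algebra_simps)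
  qed simp
  define a where "a = - \<bar>f 0\<bar> - \<bar>j\<bar>"
  have a: "f a \<le> j" using grow[of a "nat (- a)"] by (auto simp: a_def)
  define n where "n = (LEAST n. j < f (a + int n))"
  have "j < f (a + int (nat (j - f a) + 1))"
    using grow[of a "nat (j - f a) + 1"] a by linarith
  then have n: "j < f (a + int n)" unfolding n_def by (rule LeastI)
  with a have "n \<noteq> 0" by (cases "n = 0") auto
  then obtain m where m: "n = Suc m" by (cases n) auto
  then have "\<not> j < f (a + int m)"
    unfolding n_def by (metis lessI not_less_Least)
  then show ?thesis using n m by (intro exI[of _ "a + int m"]) (simp add: algebra_simps)
qed

lemma subst_point_at_block_start:
  assumes s: "substitution A B \<sigma>" and y: "range y \<subseteq> A" and t: "t < length (\<sigma> [y i])"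
  shows "subst_point \<sigma> y (block_start \<sigma> y i + int t) = \<sigma> [y i] ! t"
proof -
  note fl = factor_in_lists[OF y]
  define j where "j = block_start \<sigma> y i + int t"
  show ?thesis
  proof (cases "i \<ge> 0")
    case True
    define J where "J = nat j"
    have j: "j = int J" "J = length (\<sigma> (factor y 0 (nat i))) + t"
      using True by (auto simp: J_def j_def block_start_def)
    have "nat i \<le> J"
      using substitution_length_ge[OF s fl, of 0 "nat i"] j by simp
    then have "J + 1 = nat i + (1 + (J - nat i))" by simp
    then have "\<sigma> (factor y 0 (J + 1)) = \<sigma> (factor y 0 (nat i)) @ \<sigma> [y i] @ \<sigma> (factor y (i + 1) (J - nat i))"
      using True by (simp only: substitution_factor_add[OF s y]) simp
    then have "\<sigma> (factor y 0 (J + 1)) ! J = \<sigma> [y i] ! t"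
      using t j(2) by (simp add: nth_append)
    then show ?thesis using j(1) by (simp add: subst_point_def flip: j_def)
  next
    case False
    define R where "R = \<sigma> (factor y (i + 1) (nat (- i - 1)))"
    define J where "J = nat (- j)"
    have "nat (- i) = Suc (nat (- i - 1))" using False by simp
    then have "\<sigma> (factor y i (nat (- i))) = \<sigma> [y i] @ R"
      by (simp only: R_def substitution_factor_Suc[OF s y])
    then have jR: "j = int t - int (length (\<sigma> [y i])) - int (length R)"
      using False by (simp add: j_def block_start_def)
    have "nat (- i - 1) \<le> length R"
      unfolding R_def using substitution_length_ge[OF s fl, of "i + 1" "nat (- i - 1)"] by simp
    then have ji: "j \<le> i" "j < 0" using jR t False by auto
    then have "J = nat (i - j) + (1 + nat (- i - 1))" using False by (simp add: J_def)
    then have eq: "\<sigma> (factor y j J) = \<sigma> (factor y j (nat (i - j))) @ \<sigma> [y i] @ R"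
      using ji by (simp only: substitution_factor_add[OF s y] R_def) simp
    have "length (\<sigma> (factor y j J)) - Suc (J - 1) = length (\<sigma> (factor y j (nat (i - j)))) + t"
      using eq jR t ji by (simp add: J_def)
    moreover have "J - 1 < length (\<sigma> (factor y j J))"
      using eq jR t ji by (simp add: J_def)
    ultimately have "rev (\<sigma> (factor y j J)) ! (J - 1) = \<sigma> (factor y j J) ! (length (\<sigma> (factor y j (nat (i - j)))) + t)"
      by (simp only: rev_nth)
    also have "\<dots> = \<sigma> [y i] ! t" unfolding eq using t by (simp add: nth_append)
    finally show ?thesis using ji unfolding j_def[symmetric] subst_point_def J_def by simp
  qed
qed

text \<open>A point that carries the images of the letters of \<open>y\<close> consecutively is a translate of the image
  of \<open>y\<close>: the blocks leave no coordinate uncovered. All identities about images of points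
  follow from this.\<close>

lemma subst_point_unique:
  assumes s: "substitution A B \<sigma>" and y: "range y \<subseteq> A"
    and d: "\<And>i. d (i + 1) = d i + int (length (\<sigma> [y i]))"
    and x: "\<And>i t. t < length (\<sigma> [y i]) \<Longrightarrow> x (d i + int t) = \<sigma> [y i] ! t"
  shows "x (j + d 0) = subst_point \<sigma> y j"
proof -
  have d_eq: "d i = d 0 + block_start \<sigma> y i" for i
  proof (induction i rule: int_induct[where k = 0])
    case base
    then show ?case by (simp add: block_start_0[OF s])
  next
    case (step1 i)
    then show ?case using block_start_Suc[OF s y, of i] d[of i] by simp
  next
    case (step2 i)
    then show ?case using block_start_Suc[OF s y, of "i - 1"] d[of "i - 1"] by simp
  qed
  obtain i where i: "block_start \<sigma> y i \<le> j" "j < block_start \<sigma> y (i + 1)"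
    using increasing_int_sequence_covers[of "block_start \<sigma> y"] block_start_less_Suc[OF s y] by blast
  define t where "t = nat (j - block_start \<sigma> y i)"
  have t: "j = block_start \<sigma> y i + int t" "t < length (\<sigma> [y i])"
    using i block_start_Suc[OF s y, of i] by (auto simp: t_def)
  have "x (j + d 0) = x (d i + int t)" using t(1) d_eq[of i] by (simp add: algebra_simps)
  then show ?thesis using x[OF t(2)] subst_point_at_block_start[OF s y t(2)] t(1) by simp
qed

lemma factor_subst_point:
  assumes s: "substitution A B \<sigma>" and y: "range y \<subseteq> A"
  shows "factor (subst_point \<sigma> y) (block_start \<sigma> y i) (length (\<sigma> (factor y i l))) = \<sigma> (factor y i l)"
proof (induction l arbitrary: i)
  case 0
  then show ?case by (simp add: substitution_Nil[OF s])
next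
  case (Suc l)
  have eq: "\<sigma> (factor y i (Suc l)) = \<sigma> [y i] @ \<sigma> (factor y (i + 1) l)"
    by (rule substitution_factor_Suc[OF s y])
  have "factor (subst_point \<sigma> y) (block_start \<sigma> y i) (length (\<sigma> [y i])) = \<sigma> [y i]"
    by (rule factor_eqI) (simp_all add: subst_point_at_block_start[OF s y])
  then show ?case
    using Suc[of "i + 1"] block_start_Suc[OF s y, of i] by (simp add: eq factor_add)
qed

lemma subst_point_translate:
  assumes s: "substitution A B \<sigma>" and y: "range y \<subseteq> A"
  shows "subst_point \<sigma> (\<lambda>j. y (j + i)) = (\<lambda>j. subst_point \<sigma> y (j + block_start \<sigma> y i))"
proof
  fix j
  have y': "range (\<lambda>j. y (j + i)) \<subseteq> A" using y by auto
  have "subst_point \<sigma> y (j + block_start \<sigma> y (0 + i)) = subst_point \<sigma> (\<lambda>j. y (j + i)) j"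
  proof (rule subst_point_unique[OF s y', of "\<lambda>k. block_start \<sigma> y (k + i)"])
    show "block_start \<sigma> y (k + 1 + i) = block_start \<sigma> y (k + i) + int (length (\<sigma> [y (k + i)]))" for k
      using block_start_Suc[OF s y, of "k + i"] by (simp add: algebra_simps)
  qed (simp add: subst_point_at_block_start[OF s y])
  then show "subst_point \<sigma> (\<lambda>j. y (j + i)) j = subst_point \<sigma> y (j + block_start \<sigma> y i)" by simp
qed

lemma subst_point_range:
  assumes s: "substitution A B \<sigma>" and y: "range y \<subseteq> A"
  shows "range (subst_point \<sigma> y) \<subseteq> B"
proof
  fix b assume "b \<in> range (subst_point \<sigma> y)"
  then obtain j where b: "b = subst_point \<sigma> y j" by blast
  obtain i where i: "block_start \<sigma> y i \<le> j" "j < block_start \<sigma> y (i + 1)"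
    using increasing_int_sequence_covers[of "block_start \<sigma> y"] block_start_less_Suc[OF s y] by blast
  define t where "t = nat (j - block_start \<sigma> y i)"
  have t: "j = block_start \<sigma> y i + int t" "t < length (\<sigma> [y i])"
    using i block_start_Suc[OF s y, of i] by (auto simp: t_def)
  have "\<sigma> [y i] \<in> lists B" using substitution_lists[OF s, of "[y i]"] y by auto
  then show "b \<in> B" using subst_point_at_block_start[OF s y t(2)] t b by (metis in_listsD nth_mem)
qed

lemma subst_point_compose:
  assumes r: "substitution A B \<rho>" and s: "substitution B C \<sigma>" and y: "range y \<subseteq> A"
    and rs: "substitution A C (\<sigma> \<circ> \<rho>)"
  shows "subst_point (\<sigma> \<circ> \<rho>) y = subst_point \<sigma> (subst_point \<rho> y)"
proof
  fix j
  define z where "z = subst_point \<rho> y"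
  have z: "range z \<subseteq> B" unfolding z_def by (rule subst_point_range[OF r y])
  define d where "d i = block_start \<sigma> z (block_start \<rho> y i)" for i
  have z_block: "factor z (block_start \<rho> y i) (length (\<rho> [y i])) = \<rho> [y i]" for i
    using factor_subst_point[OF r y, of i 1] by (simp add: z_def)
  have "subst_point \<sigma> z (j + d 0) = subst_point (\<sigma> \<circ> \<rho>) y j"
  proof (rule subst_point_unique[OF rs y])
    show "d (i + 1) = d i + int (length ((\<sigma> \<circ> \<rho>) [y i]))" for i
      using block_start_add[OF s z, of "block_start \<rho> y i" "length (\<rho> [y i])"] z_block[of i] block_start_Suc[OF r y, of i]
      by (simp add: d_def)
    have "factor (subst_point \<sigma> z) (d i) (length (\<sigma> (\<rho> [y i]))) = \<sigma> (\<rho> [y i])" for i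
      using factor_subst_point[OF s z, of "block_start \<rho> y i" "length (\<rho> [y i])"] z_block[of i]
      by (simp add: d_def)
    then show "subst_point \<sigma> z (d i + int t) = (\<sigma> \<circ> \<rho>) [y i] ! t"
      if "t < length ((\<sigma> \<circ> \<rho>) [y i])" for i t
      using that by (metis comp_apply nth_factor)
  qed
  then show "subst_point (\<sigma> \<circ> \<rho>) y j = subst_point \<sigma> (subst_point \<rho> y) j"
    by (simp add: d_def block_start_0[OF r] block_start_0[OF s] flip: z_def)
qed

lemma agree_subst_point:
  assumes "agree N y y'"
  shows "agree N (subst_point \<sigma> y) (subst_point \<sigma> y')"
  unfolding agree_def
proof (intro allI impI)
  fix i assume i: "\<bar>i\<bar> \<le> int N"
  have "factor y 0 (nat i + 1) = factor y' 0 (nat i + 1)" if "i \<ge> 0"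
    using factor_cong_agree[OF assms, of 0 "nat i + 1"] i that by simp
  moreover have "factor y i (nat (- i)) = factor y' i (nat (- i))" if "i < 0"
    using factor_cong_agree[OF assms, of i "nat (- i)"] i that by simp
  ultimately show "subst_point \<sigma> y i = subst_point \<sigma> y' i"
    by (auto simp: subst_point_def)
qed


section \<open>Words and points generated by a directive sequence\<close>

lemma substitution_onto: "substitution A B \<sigma> \<Longrightarrow> b \<in> B \<Longrightarrow> \<exists>a\<in>A. b \<in> set (\<sigma> [a])"
  unfolding substitution_def by blast

lemma sublist_singleton: "a \<in> set w \<Longrightarrow> sublist [a] w"
  by (metis split_list sublist_def append_Cons append_Nil)

locale directive =
  fixes A :: "nat \<Rightarrow> 'a set" and \<tau> :: "nat \<Rightarrow> 'a list \<Rightarrow> 'a list"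
  assumes dir: "directive_sequence A \<tau>"
begin

abbreviation X :: "nat \<Rightarrow> (int \<Rightarrow> 'a) set"
  where "X \<equiv> level_subshift A \<tau>"

abbreviation comp :: "nat \<Rightarrow> nat \<Rightarrow> 'a list \<Rightarrow> 'a list"
  where "comp \<equiv> subst_comp \<tau>"

abbreviation ht :: "nat \<Rightarrow> 'a list \<Rightarrow> nat"
  where "ht \<equiv> height \<tau>"

lemma finite_alphabet [simp]: "finite (A n)"
  using dir by (simp add: directive_sequence_def alphabet_def)

lemma card_alphabet: "card (A n) \<ge> 2"
  using dir by (simp add: directive_sequence_def alphabet_def)

lemma alphabet_nonempty: "A n \<noteq> {}"
  using card_alphabet[of n] by auto

lemma comp_refl [simp]: "comp n n u = u"
  by (simp add: subst_comp_def)

lemma comp_trans: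
  assumes "n \<le> l" "l \<le> m"
  shows "comp n m u = comp n l (comp l m u)"
proof -
  have foldr: "foldr (\<circ>) fs g v = foldr (\<circ>) fs id (g v)" for fs v and g :: "'a list \<Rightarrow> 'a list"
    by (induction fs) auto
  have "[n..<m] = [n..<l] @ [l..<m]"
    using upt_add_eq_append[of n l "m - l"] assms by simp
  then have "comp n m u = foldr (\<circ>) (map \<tau> [n..<l]) (comp l m) u"
    by (simp add: subst_comp_def)
  also have "\<dots> = comp n l (comp l m u)"
    unfolding subst_comp_def[of \<tau> n l] by (rule foldr)
  finally show ?thesis .
qed

lemma comp_Suc: "comp n (Suc n) u = \<tau> n u"
  by (simp add: subst_comp_def)

lemma comp_fun_trans: "n \<le> l \<Longrightarrow> l \<le> m \<Longrightarrow> comp n m = comp n l \<circ> comp l m"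
  by (rule ext) (simp add: comp_trans[of n l m])

lemma substitution_comp:
  assumes "n \<le> m"
  shows "substitution (A m) (A n) (comp n m)"
  using assms
proof (induction m rule: dec_induct)
  case base
  show ?case by (simp add: substitution_def)
next
  case (step m)
  have t: "substitution (A (Suc m)) (A m) (\<tau> m)"
    using dir by (simp add: directive_sequence_def)
  note s = step.IH
  have eq: "comp n (Suc m) u = comp n m (\<tau> m u)" for u
    using comp_trans[of n m "Suc m" u] step.hyps comp_Suc by simp
  show ?case
    unfolding substitution_def eq
  proof (intro conjI ballI)
    fix u assume u: "u \<in> lists (A (Suc m))"
    note tu = substitution_lists[OF t u]
    show "comp n m (\<tau> m u) \<in> lists (A n)" by (rule substitution_lists[OF s tu])
    fix v assume v: "v \<in> lists (A (Suc m))"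
    show "comp n m (\<tau> m (u @ v)) = comp n m (\<tau> m u) @ comp n m (\<tau> m v)"
      by (simp add: substitution_append[OF t u v] substitution_append[OF s tu substitution_lists[OF t v]])
  next
    fix a assume a: "a \<in> A (Suc m)"
    then have "\<tau> m [a] \<in> lists (A m)" "\<tau> m [a] \<noteq> []"
      using substitution_lists[OF t, of "[a]"] substitution_letter_nonempty[OF t] by auto
    then show "comp n m (\<tau> m [a]) \<noteq> []"
      using substitution_length_ge[OF s, of "\<tau> m [a]"] by fastforce
  next
    fix b assume "b \<in> A n"
    then obtain c where c: "c \<in> A m" "b \<in> set (comp n m [c])"
      using substitution_onto[OF s] by blast
    then obtain a where a: "a \<in> A (Suc m)" "c \<in> set (\<tau> m [a])"
      using substitution_onto[OF t] by blast
    then have "sublist [c] (\<tau> m [a])" by (meson sublist_singleton)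
    from substitution_sublist[OF s this] have "sublist (comp n m [c]) (comp n m (\<tau> m [a]))"
      using substitution_lists[OF t, of "[a]"] a by auto
    then show "\<exists>a\<in>A (Suc m). b \<in> set (comp n m (\<tau> m [a]))"
      using c a set_mono_sublist by blast
  qed
qed

lemma comp_in_lists: "n \<le> m \<Longrightarrow> u \<in> lists (A m) \<Longrightarrow> comp n m u \<in> lists (A n)"
  using substitution_lists[OF substitution_comp] .

lemma comp_append:
  "n \<le> m \<Longrightarrow> u \<in> lists (A m) \<Longrightarrow> v \<in> lists (A m) \<Longrightarrow> comp n m (u @ v) = comp n m u @ comp n m v"
  using substitution_append[OF substitution_comp] .

lemma comp_length_ge: "n \<le> m \<Longrightarrow> u \<in> lists (A m) \<Longrightarrow> length u \<le> length (comp n m u)"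
  using substitution_length_ge[OF substitution_comp] .

lemma comp_letter_nonempty: "n \<le> m \<Longrightarrow> a \<in> A m \<Longrightarrow> comp n m [a] \<noteq> []"
  using substitution_letter_nonempty[OF substitution_comp] .

lemma height_append:
  "u \<in> lists (A n) \<Longrightarrow> v \<in> lists (A n) \<Longrightarrow> ht n (u @ v) = ht n u + ht n v"
  by (simp add: height_def comp_append)

lemma height_Nil [simp]: "ht n [] = 0"
  unfolding height_def using substitution_Nil[OF substitution_comp] by simp

lemma height_comp: "n \<le> m \<Longrightarrow> ht n (comp n m u) = ht m u"
  by (simp add: height_def comp_trans[of 0 n m])

text \<open>Images from level \<open>n\<close> itself are admitted, unlike in the definition of the subshift of level \<open>n\<close>.
  This does not change the factors, since every letter occurs in the image of a letter of any
  higher level, and it turns \<open>comp n m\<close> into a map from words of level \<open>m\<close> to words of level \<open>n\<close>.\<close>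

definition words :: "nat \<Rightarrow> 'a list set"
  where "words n = {w. \<exists>m\<ge>n. \<exists>a\<in>A m. sublist w (comp n m [a])}"

lemma wordsI: "n \<le> m \<Longrightarrow> a \<in> A m \<Longrightarrow> sublist w (comp n m [a]) \<Longrightarrow> w \<in> words n"
  by (auto simp: words_def)

lemma words_sublist: "w \<in> words n \<Longrightarrow> sublist v w \<Longrightarrow> v \<in> words n"
  unfolding words_def by (auto intro: sublist_order.order_trans)

lemma words_in_lists: "w \<in> words n \<Longrightarrow> w \<in> lists (A n)"
proof -
  assume "w \<in> words n"
  then obtain m a where m: "n \<le> m" "a \<in> A m" "sublist w (comp n m [a])"
    by (auto simp: words_def)
  then have "comp n m [a] \<in> lists (A n)" by (intro comp_in_lists) auto
  then show ?thesis using m(3) sublist_in_lists by blast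
qed

lemma letter_occurs_above:
  assumes "m \<le> m'" "a \<in> A m"
  shows "\<exists>a'\<in>A m'. sublist [a] (comp m m' [a'])"
proof -
  obtain a' where "a' \<in> A m'" "a \<in> set (comp m m' [a'])"
    using substitution_onto[OF substitution_comp[OF assms(1)] assms(2)] by blast
  then show ?thesis by (meson sublist_singleton)
qed

lemma words_at_high_level:
  assumes "w \<in> words n"
  shows "\<exists>m\<ge>M. m > n \<and> (\<exists>a\<in>A m. sublist w (comp n m [a]))"
proof -
  obtain m a where m: "m \<ge> n" "a \<in> A m" "sublist w (comp n m [a])"
    using assms by (auto simp: words_def)
  define m' where "m' = max M (Suc m)"
  have mm': "m \<le> m'" by (simp add: m'_def)
  obtain a' where a': "a' \<in> A m'" "sublist [a] (comp m m' [a'])"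
    using letter_occurs_above[OF mm' m(2)] by blast
  have "sublist (comp n m [a]) (comp n m (comp m m' [a']))"
    by (rule substitution_sublist[OF substitution_comp[OF m(1)] a'(2)])
      (rule comp_in_lists[OF mm'], simp add: a')
  then have "sublist w (comp n m' [a'])"
    using m(3) comp_trans[OF m(1) mm'] sublist_order.order_trans by metis
  then show ?thesis using a'(1) m(1) by (intro exI[of _ m']) (auto simp: m'_def)
qed

lemma words_comp:
  assumes "n \<le> m" "w \<in> words m"
  shows "comp n m w \<in> words n"
proof -
  obtain l a where l: "l \<ge> m" "a \<in> A l" "sublist w (comp m l [a])"
    using assms by (auto simp: words_def)
  have "sublist (comp n m w) (comp n m (comp m l [a]))"
    by (rule substitution_sublist[OF substitution_comp[OF assms(1)] l(3)])
      (rule comp_in_lists[OF l(1)], simp add: l)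
  then have "sublist (comp n m w) (comp n l [a])"
    using comp_trans[OF assms(1) l(1)] by simp
  then show ?thesis using l assms by (intro wordsI[of n l a]) auto
qed

lemma level_subshift_iff: "x \<in> X n \<longleftrightarrow> range x \<subseteq> A n \<and> (\<forall>i k. factor x i k \<in> words n)"
proof -
  have "(\<exists>m>n. \<exists>a\<in>A m. sublist w (comp n m [a])) \<longleftrightarrow> w \<in> words n" for w
    using words_at_high_level[of w n 0] by (auto simp: words_def intro: less_imp_le)
  then show ?thesis by (simp add: level_subshift_def)
qed

lemma level_subshift_range: "x \<in> X n \<Longrightarrow> range x \<subseteq> A n"
  by (simp add: level_subshift_iff)

lemma level_subshift_letter: "x \<in> X n \<Longrightarrow> x i \<in> A n"
  using level_subshift_range by blast

lemma level_subshift_translate: "x \<in> X n \<Longrightarrow> (\<lambda>j. x (j + c)) \<in> X n"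
  unfolding level_subshift_iff factor_translate by auto

lemma level_subshift_closed:
  assumes "\<And>N. \<exists>y\<in>X n. agree N y x"
  shows "x \<in> X n"
  unfolding level_subshift_iff
proof (intro conjI allI image_subsetI)
  fix i k
  obtain y where y: "y \<in> X n" "agree (nat \<bar>i\<bar> + k) y x" using assms by blast
  have "factor y i k = factor x i k"
    by (rule factor_cong_agree[OF y(2)]) auto
  then show "factor x i k \<in> words n"
    using y(1) by (metis level_subshift_iff)
  show "x i \<in> A n"
    using y level_subshift_letter[OF y(1), of i] by (simp add: agree_def)
qed

lemma subst_point_level_subshift:
  assumes "n \<le> m" "y \<in> X m"
  shows "subst_point (comp n m) y \<in> X n"
proof -
  note s = substitution_comp[OF assms(1)] and y = level_subshift_range[OF assms(2)]
  have "factor (subst_point (comp n m) y) i k \<in> words n" for i k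
  proof -
    obtain p where p: "block_start (comp n m) y p \<le> i" "i < block_start (comp n m) y (p + 1)"
      using increasing_int_sequence_covers[of "block_start (comp n m) y"] block_start_less_Suc[OF s y] by blast
    have "i + int k \<le> block_start (comp n m) y p + int (length (comp n m (factor y p (k + 1))))"
    proof -
      have "comp n m (factor y p (Suc k)) = comp n m [y p] @ comp n m (factor y (p + 1) k)"
        by (rule substitution_factor_Suc[OF s y])
      moreover have "k \<le> length (comp n m (factor y (p + 1) k))"
        using comp_length_ge[OF assms(1) factor_in_lists[OF y], of "p + 1" k] by simp
      ultimately show ?thesis using p block_start_Suc[OF s y, of p] by simp
    qed
    then have "sublist (factor (subst_point (comp n m) y) i k) (comp n m (factor y p (k + 1)))"
      using sublist_factor[OF p(1)] factor_subst_point[OF s y, of p "k + 1"] by metis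
    moreover have "factor y p (k + 1) \<in> words m" using assms(2) by (simp only: level_subshift_iff)
    ultimately show ?thesis using words_comp[OF assms(1)] words_sublist by blast
  qed
  then show ?thesis using subst_point_range[OF s y] by (simp add: level_subshift_iff)
qed

lemma subst_point_comp_trans:
  assumes "n \<le> l" "l \<le> m" "y \<in> X m"
  shows "subst_point (comp n m) y = subst_point (comp n l) (subst_point (comp l m) y)"
  using subst_point_compose[OF substitution_comp[OF assms(2)] substitution_comp[OF assms(1)]
      level_subshift_range[OF assms(3)]] substitution_comp[of n m] assms
  by (simp add: comp_fun_trans[OF assms(1,2)])

end


locale primitive_directive = directive +
  assumes prim: "primitive_sequence A \<tau>"
begin

lemma primitivity: "\<exists>m>n. \<forall>a\<in>A m. A n \<subseteq> set (comp n m [a])"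
  using prim unfolding primitive_sequence_def by blast

text \<open>Each application of primitivity lengthens the images, as every alphabet has two letters.\<close>

lemma images_grow: "\<exists>m>n. \<forall>m'\<ge>m. \<forall>a\<in>A m'. N \<le> length (comp n m' [a])"
proof -
  have "\<exists>m>n. \<forall>a\<in>A m. N \<le> length (comp n m [a])"
  proof (induction N)
    case 0
    show ?case by (meson le0 lessI)
  next
    case (Suc N)
    then obtain m where m: "m > n" "\<forall>a\<in>A m. N \<le> length (comp n m [a])" by blast
    obtain m' where m': "m' > m" "\<forall>a\<in>A m'. A m \<subseteq> set (comp m m' [a])"
      using primitivity by blast
    have "Suc N \<le> length (comp n m' [a])" if a: "a \<in> A m'" for a
    proof -
      define w where "w = comp m m' [a]"
      have w: "w \<in> lists (A m)" unfolding w_def using m' a by (intro comp_in_lists) auto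
      have "card (A m) \<le> length w"
        using m'(2) a card_mono[of "set w" "A m"] card_length[of w] by (simp add: w_def)
      then have "2 \<le> length w" using card_alphabet[of m] by simp
      then obtain b v where bv: "w = b # v" "v \<noteq> []"
        by (cases w; cases "tl w") auto
      have "comp n m w = comp n m [b] @ comp n m v"
        using comp_append[of n m "[b]" v] w m bv by simp
      moreover have "1 \<le> length v" "length v \<le> length (comp n m v)"
        using bv w m(1) comp_length_ge[of n m v] by (simp_all add: Suc_le_eq)
      moreover have "N \<le> length (comp n m [b])" using m(2) w bv by auto
      ultimately show ?thesis using comp_trans[of n m m' "[a]"] m m' by (simp add: w_def)
    qed
    then show ?case using m(1) m'(1) by (meson less_trans)
  qed
  then obtain m where m: "m > n" "\<forall>a\<in>A m. N \<le> length (comp n m [a])" by blast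
  have "N \<le> length (comp n m' [a])" if m': "m' \<ge> m" and a: "a \<in> A m'" for m' a
  proof -
    obtain b v where bv: "comp m m' [a] = b # v"
      using comp_letter_nonempty[OF m' a] by (cases "comp m m' [a]") auto
    have "b # v \<in> lists (A m)" unfolding bv[symmetric] using m' a by (intro comp_in_lists) auto
    then have "comp n m (b # v) = comp n m [b] @ comp n m v" "b \<in> A m"
      using comp_append[of n m "[b]" v] m by auto
    then show ?thesis using m m' comp_trans[of n m m' "[a]"] bv by auto
  qed
  with m(1) show ?thesis by blast
qed

text \<open>A word \<open>w\<close> below a letter \<open>a\<close> occurs deep inside the image of a letter of a much higher level:
  primitivity puts \<open>a\<close> below every letter of some level, in particular below one in the middle of
  a long image.\<close>

lemma words_extend:
  assumes "w \<in> words n"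
  shows "\<exists>u v. length u = R \<and> length v = R \<and> u @ w @ v \<in> words n"
proof -
  obtain m a where m: "m \<ge> n" "a \<in> A m" "sublist w (comp n m [a])"
    using assms by (auto simp: words_def)
  obtain m1 where m1: "m1 > m" "\<forall>c\<in>A m1. A m \<subseteq> set (comp m m1 [c])"
    using primitivity by blast
  obtain m2 where m2: "m2 > m1" "\<forall>d\<in>A m2. 2 * R + 1 \<le> length (comp m1 m2 [d])"
    using images_grow[of m1 "2 * R + 1"] by blast
  obtain d where d: "d \<in> A m2" using alphabet_nonempty by blast
  define z where "z = comp m1 m2 [d]"
  have z: "z \<in> lists (A m1)" "2 * R + 1 \<le> length z"
    unfolding z_def using m2 d comp_in_lists[of m1 m2 "[d]"] by auto
  define u1 v1 where "u1 = take R z" and "v1 = drop (Suc R) z"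
  have z_eq: "z = u1 @ [z ! R] @ v1"
    unfolding u1_def v1_def using z(2) id_take_nth_drop[of R z] by simp
  have lens: "length u1 = R" "R \<le> length v1" using z(2) by (auto simp: u1_def v1_def)
  have zR: "u1 \<in> lists (A m1)" "z ! R \<in> A m1" "v1 \<in> lists (A m1)"
    using z(1) by (subst (asm) z_eq, simp)+
  obtain p q where pq: "comp m m1 [z ! R] = p @ a # q"
    using m1(2) zR(2) m(2) by (meson split_list subsetD)
  have pq_lists: "p \<in> lists (A m)" "q \<in> lists (A m)"
    using comp_in_lists[of m m1 "[z ! R]"] m1 zR(2) pq by auto
  obtain l r where lr: "comp n m [a] = l @ w @ r" using m(3) by (auto simp: sublist_def)
  define u2 where "u2 = comp m m1 u1 @ p"
  define v2 where "v2 = q @ comp m m1 v1"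
  have uv2: "u2 \<in> lists (A m)" "v2 \<in> lists (A m)"
    unfolding u2_def v2_def using pq_lists comp_in_lists[of m m1] zR m1(1)
    by (simp_all del: in_lists_conv_set)
  have len2: "R \<le> length u2" "R \<le> length v2"
    using comp_length_ge[of m m1 u1] comp_length_ge[of m m1 v1] zR m1(1) lens
    by (auto simp: u2_def v2_def simp del: in_lists_conv_set)
  have "comp m m1 z = u2 @ [a] @ v2"
    using comp_append[of m m1 u1 "[z ! R] @ v1"] comp_append[of m m1 "[z ! R]" v1] zR m1(1) pq
    by (subst z_eq) (simp add: u2_def v2_def)
  then have "comp m m2 [d] = u2 @ [a] @ v2"
    using comp_trans[of m m1 m2 "[d]"] m1(1) m2(1) by (simp add: z_def)
  then have "comp n m2 [d] = comp n m u2 @ (l @ w @ r) @ comp n m v2"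
    using comp_trans[of n m m2 "[d]"] m(1,2) m1(1) m2(1) uv2
      comp_append[of n m u2 "[a] @ v2"] comp_append[of n m "[a]" v2] lr
    by simp
  then have word: "(comp n m u2 @ l) @ w @ (r @ comp n m v2) \<in> words n" (is "?u @ w @ ?v \<in> _")
    using m(1) m1(1) m2(1) d by (intro wordsI[of n m2 d]) auto
  have len3: "R \<le> length ?u" "R \<le> length ?v"
    using comp_length_ge[OF m(1) uv2(1)] comp_length_ge[OF m(1) uv2(2)] len2 by auto
  define u where "u = drop (length ?u - R) ?u"
  have "?u @ w @ ?v = take (length ?u - R) ?u @ (u @ w @ take R ?v) @ drop R ?v"
    unfolding u_def by (metis append.assoc append_take_drop_id)
  then have "sublist (u @ w @ take R ?v) (?u @ w @ ?v)" by (metis sublist_appendI)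
  then have "u @ w @ take R ?v \<in> words n" using word words_sublist by blast
  moreover have "length u = R" "length (take R ?v) = R" using len3 by (auto simp: u_def)
  ultimately show ?thesis by blast
qed

text \<open>Extend the word on both sides again and again; by compactness, the extensions accumulate at a
  point.\<close>

theorem language_level_subshift: "language (X n) = words n"
proof
  show "language (X n) \<subseteq> words n" by (auto simp: language_def level_subshift_iff)
  show "words n \<subseteq> language (X n)"
  proof
    fix w assume w: "w \<in> words n"
    define Q where "Q R y \<longleftrightarrow> factor y (- int R) (R + (length w + R)) \<in> words n
        \<and> factor y 0 (length w) = w" for R y
    have "\<exists>y. range y \<subseteq> A n \<and> (\<forall>R. Q R y)"
    proof (rule full_shift_compactness[where b = "\<lambda>R. R + length w"])
      show "finite (A n)" by simp
      show "Q R y" if "Q (Suc R) y" for R y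
      proof -
        have "sublist (factor y (- int R) (R + (length w + R)))
            (factor y (- int (Suc R)) (Suc R + (length w + Suc R)))"
          by (rule sublist_factor) auto
        then show ?thesis using that words_sublist unfolding Q_def by blast
      qed
      show "Q R y'" if "agree (R + length w) y y'" "Q R y" for R y y'
        using that factor_cong_agree[OF that(1), of "- int R" "R + (length w + R)"]
          factor_cong_agree[OF that(1), of 0 "length w"] by (simp add: Q_def)
      show "\<exists>y. range y \<subseteq> A n \<and> Q R y" for R
      proof -
        obtain u v where uv: "length u = R" "length v = R" "u @ w @ v \<in> words n"
          using words_extend[OF w] by blast
        obtain b where b: "b \<in> A n" using alphabet_nonempty by blast
        define W where "W = u @ w @ v"
        define y where "y i = (if 0 \<le> i + int R \<and> i + int R < int (length W) then W ! nat (i + int R) else b)" for i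
        have "W \<in> lists (A n)" using words_in_lists uv(3) by (simp only: W_def)
        then have "set W \<subseteq> A n" by auto
        have "y i \<in> A n" for i
          using \<open>set W \<subseteq> A n\<close> b nth_mem[of "nat (i + int R)" W] by (auto simp: y_def nat_less_iff)
        then have "range y \<subseteq> A n" by blast
        moreover have yW: "factor y (- int R) (R + (length w + R)) = W"
          by (rule factor_eqI) (auto simp: y_def W_def uv)
        moreover from yW have "factor y 0 (length w) = w"
          unfolding factor_add W_def by (simp add: uv)
        moreover have "W \<in> words n" using uv(3) by (simp only: W_def)
        ultimately show ?thesis unfolding Q_def by auto
      qed
    qed
    then obtain y where y: "range y \<subseteq> A n" "\<And>R. Q R y" by blast
    have "factor y i k \<in> words n" for i k
    proof -
      define R where "R = nat \<bar>i\<bar> + k"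
      have "sublist (factor y i k) (factor y (- int R) (R + (length w + R)))"
        by (rule sublist_factor) (auto simp: R_def)
      then show ?thesis using y(2)[of R] words_sublist unfolding Q_def by blast
    qed
    then have "y \<in> X n" using y(1) by (simp add: level_subshift_iff)
    moreover have "w = factor y 0 (length w)" using y(2) by (simp add: Q_def)
    ultimately show "w \<in> language (X n)" unfolding language_def by blast
  qed
qed

end


section \<open>Towers\<close>

lemma finite_pigeonhole_decreasing:
  fixes P :: "'i \<Rightarrow> nat \<Rightarrow> bool"
  assumes "finite I" "\<And>N. \<exists>i\<in>I. P i N" "\<And>i M N. M \<le> N \<Longrightarrow> P i N \<Longrightarrow> P i M"
  shows "\<exists>i\<in>I. \<forall>N. P i N"
proof (rule ccontr)
  assume "\<not> ?thesis"
  then obtain f where f: "\<And>i. i \<in> I \<Longrightarrow> \<not> P i (f i)" by metis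
  obtain i where "i \<in> I" "P i (Max (f ` I))" using assms(2) by blast
  then show False using f assms(1,3) by (meson Max_ge finite_imageI imageI)
qed

context directive
begin

definition tower_floor :: "nat \<Rightarrow> 'a \<Rightarrow> nat \<Rightarrow> (int \<Rightarrow> 'a) set"
  where "tower_floor n a k = {\<lambda>j. subst_point (comp 0 n) y (j + int k) | y. y \<in> X n \<and> y 0 = a}"

definition floors :: "nat \<Rightarrow> ('a \<times> nat) set"
  where "floors n = {(a, k). a \<in> A n \<and> k < ht n [a]}"

lemma tower_floor_eq_shift: "tower_floor n a k = (shift_map ^^ k) ` tower_base A \<tau> n a"
  by (auto simp: tower_floor_def tower_base_def shift_map_funpow)

lemma finite_floors: "finite (floors n)"
proof -
  have "floors n = (SIGMA a : A n. {..<ht n [a]})" by (auto simp: floors_def)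
  then show ?thesis by simp
qed

text \<open>Floors are closed, being continuous images of compact sets.\<close>

lemma tower_floor_closed:
  assumes x: "\<And>N. \<exists>z\<in>tower_floor n a k. agree N x z"
  shows "x \<in> tower_floor n a k"
proof -
  define \<sigma> where "\<sigma> = subst_point (comp 0 n)"
  define Q where "Q N y' \<longleftrightarrow> (\<exists>y\<in>X n. y 0 = a \<and> agree N y y' \<and> agree N x (\<lambda>j. \<sigma> y (j + int k)))"
    for N y'
  have "\<exists>y. range y \<subseteq> A n \<and> (\<forall>N. Q N y)"
  proof (rule full_shift_compactness[where b = "\<lambda>N. N"])
    show "finite (A n)" by simp
    show "Q N y" if "Q (Suc N) y" for N y
      using that unfolding Q_def by (meson agree_mono le_SucI order_refl)
    show "Q N y'" if "agree N y y'" "Q N y" for N y y'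
      using that unfolding Q_def by (meson agree_trans)
    show "\<exists>y. range y \<subseteq> A n \<and> Q N y" for N
    proof -
      obtain y where "y \<in> X n" "y 0 = a" "agree N x (\<lambda>j. \<sigma> y (j + int k))"
        using x[of N] by (auto simp: tower_floor_def \<sigma>_def)
      then show ?thesis
        unfolding Q_def using level_subshift_range agree_refl by blast
    qed
  qed
  then obtain y' where y': "\<And>N. Q N y'" by blast
  have "y' \<in> X n"
    by (rule level_subshift_closed) (use y' in \<open>auto simp: Q_def\<close>)
  moreover have "y' 0 = a"
    using y'[of 0] by (auto simp: Q_def agree_def)
  moreover have "x j = \<sigma> y' (j + int k)" for j
  proof -
    define N where "N = nat \<bar>j\<bar> + k"
    obtain y where y: "agree N y y'" "agree N x (\<lambda>j. \<sigma> y (j + int k))"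
      using y'[of N] by (auto simp: Q_def)
    have "agree N (\<sigma> y) (\<sigma> y')" unfolding \<sigma>_def by (rule agree_subst_point[OF y(1)])
    then show ?thesis using y(2) by (simp add: agree_def N_def)
  qed
  ultimately show ?thesis unfolding tower_floor_def \<sigma>_def by blast
qed

lemma translate_in_tower_floor:
  assumes y: "y \<in> X n"
  shows "\<exists>i k. (y i, k) \<in> floors n \<and> p = block_start (comp 0 n) y i + int k
    \<and> (\<lambda>j. subst_point (comp 0 n) y (j + p)) \<in> tower_floor n (y i) k"
proof -
  note s = substitution_comp[of 0 n, simplified] and r = level_subshift_range[OF y]
  obtain i where i: "block_start (comp 0 n) y i \<le> p" "p < block_start (comp 0 n) y (i + 1)"
    using increasing_int_sequence_covers[of "block_start (comp 0 n) y"] block_start_less_Suc[OF s r] by blast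
  define k where "k = nat (p - block_start (comp 0 n) y i)"
  have p: "p = block_start (comp 0 n) y i + int k" using i by (simp add: k_def)
  have "(y i, k) \<in> floors n"
    using i block_start_Suc[OF s r, of i] level_subshift_letter[OF y, of i]
    by (auto simp: floors_def height_def k_def)
  moreover have "(\<lambda>j. subst_point (comp 0 n) y (j + p)) =
      (\<lambda>j. subst_point (comp 0 n) (\<lambda>j. y (j + i)) (j + int k))"
    unfolding subst_point_translate[OF s r, of i] p by (simp add: algebra_simps)
  then have "(\<lambda>j. subst_point (comp 0 n) y (j + p)) \<in> tower_floor n (y i) k"
    unfolding tower_floor_def using level_subshift_translate[OF y, of i] by fastforce
  ultimately show ?thesis using p by blast
qed

end

context primitive_directive
begin

text \<open>Every window of a point of the subshift lies in the image of a word of level \<open>n\<close>, which occurs in a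
  point of that level. So the point is approximated by points of the floors, and these are
  finitely many closed sets.\<close>

lemma tower_cover:
  assumes x: "x \<in> X 0"
  shows "\<exists>(a, k)\<in>floors n. x \<in> tower_floor n a k"
proof -
  note s = substitution_comp[of 0 n, simplified]
  have "\<exists>(a, k)\<in>floors n. \<exists>z\<in>tower_floor n a k. agree N x z" for N
  proof -
    define K where "K = 2 * N + 1"
    have "factor x (- int N) K \<in> words 0" using x by (simp only: level_subshift_iff)
    then obtain m a where m: "m \<ge> n" "a \<in> A m" "sublist (factor x (- int N) K) (comp 0 m [a])"
      using words_at_high_level[of _ 0 n] by blast
    have "comp n m [a] \<in> language (X n)"
      unfolding language_level_subshift using m by (intro wordsI[of n m a]) auto
    then obtain y i l where y: "y \<in> X n" "comp n m [a] = factor y i l"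
      by (auto simp: language_def)
    define z where "z = subst_point (comp 0 n) y"
    have "factor z (block_start (comp 0 n) y i) (length (comp 0 n (factor y i l))) = comp 0 m [a]"
      using factor_subst_point[OF s level_subshift_range[OF y(1)], of i l] y(2)
        comp_trans[of 0 n m "[a]"] m(1) by (simp add: z_def)
    then obtain u v where uv: "factor z (block_start (comp 0 n) y i) (length (comp 0 n (factor y i l)))
        = u @ factor x (- int N) K @ v"
      using m(3) by (auto simp: sublist_def)
    define p where "p = block_start (comp 0 n) y i + int (length u) + int N"
    have "agree N x (\<lambda>j. z (j + p))"
      unfolding agree_def
    proof (intro allI impI)
      fix j assume j: "\<bar>j\<bar> \<le> int N"
      define t where "t = nat (j + int N)"
      have t: "t < K" "int t = j + int N" using j by (auto simp: t_def K_def)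
      have "length u + t < length (factor z (block_start (comp 0 n) y i) (length (comp 0 n (factor y i l))))"
        unfolding uv using t by simp
      then have "z (block_start (comp 0 n) y i + int (length u + t)) = (u @ factor x (- int N) K @ v) ! (length u + t)"
        using uv by (metis length_factor nth_factor)
      also have "\<dots> = x j" using t by (simp add: nth_append)
      finally show "x j = z (j + p)" using t by (simp add: p_def algebra_simps)
    qed
    moreover obtain i' k where "(y i', k) \<in> floors n" "(\<lambda>j. z (j + p)) \<in> tower_floor n (y i') k"
      using translate_in_tower_floor[OF y(1), of p] unfolding z_def by blast
    ultimately show ?thesis by blast
  qed
  moreover define P where "P ak N \<longleftrightarrow> (\<exists>z\<in>tower_floor n (fst ak) (snd ak). agree N x z)" for ak N
  ultimately have "\<exists>ak\<in>floors n. P ak N" for N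
    by (simp add: P_def case_prod_beta)
  moreover have "P ak M" if "M \<le> N" "P ak N" for ak M N
    using that unfolding P_def by (meson agree_mono)
  ultimately obtain ak where ak: "ak \<in> floors n" "\<And>N. P ak N"
    using finite_pigeonhole_decreasing[OF finite_floors, of n P] by blast
  obtain a k where [simp]: "ak = (a, k)" by (cases ak)
  have "x \<in> tower_floor n a k"
    by (rule tower_floor_closed) (use ak(2) in \<open>simp add: P_def\<close>)
  then show ?thesis using ak(1) by auto
qed

end


locale recognizable_directive = primitive_directive +
  assumes rec: "recognizable A \<tau>"
begin

lemma floor_unique:
  assumes "n \<ge> 1" "(a, k) \<in> floors n" "(b, l) \<in> floors n"
    "x \<in> tower_floor n a k" "x \<in> tower_floor n b l"
  shows "(a, k) = (b, l)"
proof (rule ccontr)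
  assume ne: "(a, k) \<noteq> (b, l)"
  have "disjoint_family_on (\<lambda>(a, k). tower_floor n a k) (floors n)"
    using rec assms(1) by (simp add: recognizable_def tower_floor_eq_shift floors_def)
  then have "tower_floor n a k \<inter> tower_floor n b l = {}"
    using assms(2,3) ne unfolding disjoint_family_on_def by fastforce
  then show False using assms(4,5) by blast
qed

text \<open>The time elapsed since the orbit of \<open>x\<close> last entered a tower of level \<open>n\<close> at its base.\<close>

definition entry_time :: "nat \<Rightarrow> (int \<Rightarrow> 'a) \<Rightarrow> nat"
  where "entry_time n x = (THE k. \<exists>a. (a, k) \<in> floors n \<and> x \<in> tower_floor n a k)"

lemma entry_timeI:
  assumes "n \<ge> 1" "(a, k) \<in> floors n" "x \<in> tower_floor n a k"
  shows "entry_time n x = k"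
  unfolding entry_time_def
proof (rule the_equality)
  show "l = k" if "\<exists>a. (a, l) \<in> floors n \<and> x \<in> tower_floor n a l" for l
    using that floor_unique[OF assms(1,2) _ assms(3)] by blast
qed (use assms in blast)

lemma entry_time_obtain:
  assumes "n \<ge> 1" "x \<in> X 0"
  obtains y where "y \<in> X n" "(y 0, entry_time n x) \<in> floors n"
    "x = (\<lambda>j. subst_point (comp 0 n) y (j + int (entry_time n x)))"
proof -
  obtain a k where ak: "(a, k) \<in> floors n" "x \<in> tower_floor n a k"
    using tower_cover[OF assms(2), of n] by blast
  have k: "entry_time n x = k" by (rule entry_timeI[OF assms(1) ak])
  obtain y where "y \<in> X n" "y 0 = a" "x = (\<lambda>j. subst_point (comp 0 n) y (j + int k))"
    using ak(2) by (auto simp: tower_floor_def)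
  then show thesis using that[of y] ak(1) k by simp
qed

lemma entry_time_locally_constant:
  assumes n: "n \<ge> 1" and x: "x \<in> X 0"
  shows "\<exists>N. \<forall>z\<in>X 0. agree N z x \<longrightarrow> entry_time n z = entry_time n x"
proof (rule ccontr)
  assume "\<not> ?thesis"
  then have bad: "\<exists>z\<in>X 0. agree N z x \<and> entry_time n z \<noteq> entry_time n x" for N by blast
  define P where "P ak N \<longleftrightarrow> snd ak \<noteq> entry_time n x
      \<and> (\<exists>z\<in>tower_floor n (fst ak) (snd ak). agree N x z)" for ak N
  have "\<exists>ak\<in>floors n. P ak N" for N
  proof -
    obtain z where z: "z \<in> X 0" "agree N z x" "entry_time n z \<noteq> entry_time n x"
      using bad by blast
    obtain a k where ak: "(a, k) \<in> floors n" "z \<in> tower_floor n a k"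
      using tower_cover[OF z(1), of n] by blast
    then have "P (a, k) N"
      using z(2,3) entry_timeI[OF n ak] agree_sym[OF z(2)] by (auto simp: P_def)
    then show ?thesis using ak(1) by blast
  qed
  moreover have "P ak M" if "M \<le> N" "P ak N" for ak M N
    using that unfolding P_def by (meson agree_mono)
  ultimately obtain ak where ak: "ak \<in> floors n" "\<And>N. P ak N"
    using finite_pigeonhole_decreasing[OF finite_floors, of n P] by blast
  obtain a k where [simp]: "ak = (a, k)" by (cases ak)
  have "x \<in> tower_floor n a k"
    by (rule tower_floor_closed) (use ak(2) in \<open>auto simp: P_def\<close>)
  then show False using entry_timeI[OF n, of a k x] ak by (auto simp: P_def)
qed

text \<open>Passing from level \<open>m\<close> to a lower level \<open>n\<close>, the entry time loses the height of the word of
  level \<open>n\<close> that has been read since the base of the tower of level \<open>m\<close>.\<close>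

lemma entry_time_refine:
  assumes n: "1 \<le> n" "n \<le> m" and x: "x \<in> X 0"
  shows "\<exists>u\<in>words n. entry_time m x = entry_time n x + ht n u"
proof -
  obtain y where y: "y \<in> X m" "x = (\<lambda>j. subst_point (comp 0 m) y (j + int (entry_time m x)))"
    using entry_time_obtain[of m x] n x by (metis order_trans)
  define z where "z = subst_point (comp n m) y"
  have z: "z \<in> X n" unfolding z_def by (rule subst_point_level_subshift[OF n(2) y(1)])
  have "subst_point (comp 0 m) y = subst_point (comp 0 n) z"
    unfolding z_def by (rule subst_point_comp_trans) (use n y in auto)
  then have xz: "x = (\<lambda>j. subst_point (comp 0 n) z (j + int (entry_time m x)))"
    using y(2) by simp
  obtain i k where ik: "(z i, k) \<in> floors n" "int (entry_time m x) = block_start (comp 0 n) z i + int k"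
      "(\<lambda>j. subst_point (comp 0 n) z (j + int (entry_time m x))) \<in> tower_floor n (z i) k"
    using translate_in_tower_floor[OF z, of "int (entry_time m x)"] by blast
  have k: "entry_time n x = k"
    using entry_timeI[OF n(1) ik(1)] ik(3) xz by simp
  have "block_start (comp 0 n) z (i + 1) > 0"
    using ik(1,2) block_start_Suc[OF substitution_comp level_subshift_range[OF z], of 0 i]
    by (auto simp: floors_def height_def)
  then have "i \<ge> 0"
    using block_start_nonpos[OF substitution_comp[of 0 n, OF le0], of "i + 1" z] by linarith
  then have "block_start (comp 0 n) z i = int (ht n (factor z 0 (nat i)))"
    by (simp add: block_start_def height_def)
  then have "entry_time m x = entry_time n x + ht n (factor z 0 (nat i))"
    using ik(2) k by simp
  moreover have "factor z 0 (nat i) \<in> words n" using z by (simp only: level_subshift_iff)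
  ultimately show ?thesis by blast
qed

text \<open>One step of the shift climbs one floor, unless it leaves the top of a tower for the base of the
  next one; then the entry time falls short by the height of a letter. The empty word accounts for the
  first case.\<close>

lemma entry_time_shift:
  assumes n: "1 \<le> n" and x: "x \<in> X 0"
  shows "\<exists>u\<in>words n. entry_time n x + 1 = entry_time n (shift_map x) + ht n u"
proof -
  obtain y where y: "y \<in> X n" "(y 0, entry_time n x) \<in> floors n"
      "x = (\<lambda>j. subst_point (comp 0 n) y (j + int (entry_time n x)))"
    using entry_time_obtain[OF n x] .
  define p where "p = int (entry_time n x) + 1"
  have sx: "shift_map x = (\<lambda>j. subst_point (comp 0 n) y (j + p))"
    by (subst y(3)) (simp add: shift_map_def p_def algebra_simps)
  obtain i k where ik: "(y i, k) \<in> floors n" "p = block_start (comp 0 n) y i + int k"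
      "(\<lambda>j. subst_point (comp 0 n) y (j + p)) \<in> tower_floor n (y i) k"
    using translate_in_tower_floor[OF y(1), of p] by blast
  have k: "entry_time n (shift_map x) = k"
    using entry_timeI[OF n ik(1)] ik(3) sx by simp
  have "block_start (comp 0 n) y (i + 1) > 0"
    using ik(1,2) block_start_Suc[OF substitution_comp level_subshift_range[OF y(1)], of 0 i]
    by (auto simp: floors_def height_def p_def)
  then have "i \<ge> 0"
    using block_start_nonpos[OF substitution_comp[of 0 n, OF le0], of "i + 1" y] by linarith
  then have "block_start (comp 0 n) y i = int (ht n (factor y 0 (nat i)))"
    by (simp add: block_start_def height_def)
  then have "entry_time n x + 1 = entry_time n (shift_map x) + ht n (factor y 0 (nat i))"
    using ik(2) k by (simp add: p_def)
  moreover have "factor y 0 (nat i) \<in> words n" using y(1) by (simp only: level_subshift_iff)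
  ultimately show ?thesis by blast
qed

end


section \<open>The criterion by heights of words\<close>

text \<open>Completeness of the circle: a limit point of the fractional parts works at every stage.\<close>

lemma circle_Cauchy_limit:
  fixes f e :: "nat \<Rightarrow> real"
  assumes cauchy: "\<And>n m. 1 \<le> n \<Longrightarrow> n \<le> m \<Longrightarrow> dist_nearest_int (f m - f n) \<le> e n"
  shows "\<exists>\<theta>. \<forall>n\<ge>1. dist_nearest_int (f n - \<theta>) \<le> e n"
proof -
  have "seq_compact {0..1::real}" by (intro compact_imp_seq_compact compact_Icc)
  moreover have "\<forall>n. frac (f n) \<in> {0..1}" by (simp add: frac_lt_1 less_imp_le)
  ultimately obtain \<theta> r where r: "strict_mono r" "((\<lambda>n. frac (f n)) \<circ> r) \<longlonglongrightarrow> \<theta>"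
    using seq_compactE[of "{0..1::real}" "\<lambda>n. frac (f n)"] by metis
  have approx: "dist_nearest_int (f n - \<theta>) \<le> e n + d" if n: "n \<ge> 1" and d: "d > 0" for n d
  proof -
    have "\<forall>\<^sub>F j in sequentially. \<bar>frac (f (r j)) - \<theta>\<bar> < d"
      using tendstoD[OF r(2) d] by (simp add: dist_real_def)
    then obtain j where j: "j \<ge> n" "\<bar>frac (f (r j)) - \<theta>\<bar> < d"
      unfolding eventually_sequentially by (metis linear)
    have "n \<le> r j" using j(1) seq_suble[OF r(1), of j] by linarith
    then have "dist_nearest_int (f n - f (r j)) \<le> e n"
      using cauchy[OF n, of "r j"] by (simp add: dist_nearest_int_commute)
    moreover have "dist_nearest_int (f (r j) - \<theta>) = dist_nearest_int (frac (f (r j)) - \<theta>)"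
      by (rule dist_nearest_int_cong_Ints) (simp add: frac_def)
    ultimately show ?thesis
      using dist_nearest_int_triangle[of "f n" \<theta> "f (r j)"]
        dist_nearest_int_le_abs[of "frac (f (r j)) - \<theta>"] j(2) by linarith
  qed
  have "dist_nearest_int (f n - \<theta>) \<le> e n" if "n \<ge> 1" for n
    by (rule field_le_epsilon) (rule approx[OF that])
  then show ?thesis by blast
qed

context directive
begin

definition sup_dist :: "real \<Rightarrow> nat \<Rightarrow> real"
  where "sup_dist \<alpha> n = (SUP u\<in>words n. dist_nearest_int (\<alpha> * real (ht n u)))"

lemma Nil_in_words: "[] \<in> words n"
proof -
  obtain a where "a \<in> A n" using alphabet_nonempty by blast
  then show ?thesis by (intro wordsI[of n n a]) auto
qed

lemma dist_le_sup_dist: "u \<in> words n \<Longrightarrow> dist_nearest_int (\<alpha> * real (ht n u)) \<le> sup_dist \<alpha> n"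
  unfolding sup_dist_def
  by (rule cSUP_upper) (auto intro!: bdd_aboveI[of _ "1/2"] dist_nearest_int_le_half)

lemma sup_dist_nonneg: "0 \<le> sup_dist \<alpha> n"
  using dist_le_sup_dist[OF Nil_in_words, of \<alpha> n] by simp

lemma sup_dist_le:
  "(\<And>u. u \<in> words n \<Longrightarrow> dist_nearest_int (\<alpha> * real (ht n u)) \<le> c) \<Longrightarrow> sup_dist \<alpha> n \<le> c"
  unfolding sup_dist_def using Nil_in_words by (intro cSUP_least) auto

end

context recognizable_directive
begin

text \<open>The entry times of \<open>x\<close>, multiplied by \<open>\<alpha>\<close>, form a Cauchy sequence in the circle, uniformly in \<open>x\<close>:
  entry times at different levels differ by heights of words. The limit is the eigenfunction.\<close>

theorem eigenvalue_if_sup_dist_tendsto_0: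
  assumes lim: "sup_dist \<alpha> \<longlonglongrightarrow> 0"
  shows "continuous_eigenvalue (A 0) (X 0) \<alpha>"
proof -
  define f where "f x n = \<alpha> * real (entry_time n x)" for x n
  have "\<exists>\<theta>. \<forall>n\<ge>1. dist_nearest_int (f x n - \<theta>) \<le> sup_dist \<alpha> n" if x: "x \<in> X 0" for x
  proof (rule circle_Cauchy_limit)
    fix n m :: nat assume n: "1 \<le> n" "n \<le> m"
    obtain u where u: "u \<in> words n" "entry_time m x = entry_time n x + ht n u"
      using entry_time_refine[OF n x] by blast
    show "dist_nearest_int (f x m - f x n) \<le> sup_dist \<alpha> n"
      using dist_le_sup_dist[OF u(1), of \<alpha>] by (simp add: f_def u(2) algebra_simps)
  qed
  then obtain \<theta> where \<theta>: "\<And>x n. x \<in> X 0 \<Longrightarrow> n \<ge> 1 \<Longrightarrow> dist_nearest_int (f x n - \<theta> x) \<le> sup_dist \<alpha> n"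
    by metis
  have small: "\<exists>n\<ge>1. sup_dist \<alpha> n < e" if "e > 0" for e
  proof -
    have "\<forall>\<^sub>F n in sequentially. sup_dist \<alpha> n < e" using order_tendstoD(2)[OF lim that] .
    then obtain N where "\<forall>n\<ge>N. sup_dist \<alpha> n < e" unfolding eventually_sequentially by blast
    then show ?thesis by (intro exI[of _ "max N 1"]) auto
  qed
  define g where "g x = real_mod_Z (\<theta> x)" for x
  have eigen: "g (shift_map x) = g x + real_mod_Z \<alpha>" if x: "x \<in> X 0" for x
  proof -
    have sx: "shift_map x \<in> X 0"
      using level_subshift_translate[OF x, of 1] by (simp add: shift_map_def)
    define D where "D = dist_nearest_int (\<theta> (shift_map x) - (\<theta> x + \<alpha>))"
    have D: "D \<le> 3 * sup_dist \<alpha> n" if n: "n \<ge> 1" for n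
    proof -
      obtain u where u: "u \<in> words n" "entry_time n x + 1 = entry_time n (shift_map x) + ht n u"
        using entry_time_shift[OF n x] by blast
      have "f x n + \<alpha> = \<alpha> * real (entry_time n x + 1)" by (simp add: f_def algebra_simps)
      then have "f x n + \<alpha> = f (shift_map x) n + \<alpha> * real (ht n u)"
        unfolding u(2) by (simp add: f_def algebra_simps)
      then have "\<theta> (shift_map x) - (\<theta> x + \<alpha>) =
          (f x n - \<theta> x) - (f (shift_map x) n - \<theta> (shift_map x)) - \<alpha> * real (ht n u)" (is "_ = ?p - ?q - ?r")
        by simp
      then have "D = dist_nearest_int (?p - ?q - ?r)" by (simp only: D_def)
      also have "\<dots> \<le> dist_nearest_int ?p + dist_nearest_int ?q + dist_nearest_int ?r"
        using dist_nearest_int_diff[of "?p - ?q" ?r] dist_nearest_int_diff[of ?p ?q] by linarith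
      also have "\<dots> \<le> 3 * sup_dist \<alpha> n"
        using \<theta>[OF x n] \<theta>[OF sx n] dist_le_sup_dist[OF u(1), of \<alpha>] by linarith
      finally show ?thesis .
    qed
    have "D \<le> 0 + e" if e: "e > 0" for e
    proof -
      obtain n where n: "n \<ge> 1" "sup_dist \<alpha> n < e / 3" using small[of "e / 3"] e by auto
      with D[OF n(1)] show ?thesis by simp
    qed
    then have "D \<le> 0" by (rule field_le_epsilon)
    then have "D = 0" by (simp add: D_def order_antisym)
    then show ?thesis
      by (simp add: D_def g_def dist_nearest_int_eq_0_iff real_mod_Z_eq_iff flip: real_mod_Z_add)
  qed
  have "\<exists>N. \<forall>z\<in>X 0. agree N z x \<longrightarrow> circle_norm (g z - g x) < e" if x: "x \<in> X 0" and e: "e > 0" for x e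
  proof -
    obtain n where n: "n \<ge> 1" "sup_dist \<alpha> n < e / 2" using small[of "e / 2"] e by auto
    obtain N where N: "\<And>z. z \<in> X 0 \<Longrightarrow> agree N z x \<Longrightarrow> entry_time n z = entry_time n x"
      using entry_time_locally_constant[OF n(1) x] by blast
    have "circle_norm (g z - g x) < e" if z: "z \<in> X 0" "agree N z x" for z
    proof -
      have "f z n = f x n" using N[OF z] by (simp add: f_def)
      then have "dist_nearest_int (\<theta> z - \<theta> x) < e"
        using dist_nearest_int_diff[of "f x n - \<theta> x" "f z n - \<theta> z"] \<theta>[OF x n(1)] \<theta>[OF z(1) n(1)] n(2)
        by simp
      then show ?thesis by (simp add: g_def flip: real_mod_Z_diff)
    qed
    then show ?thesis by blast
  qed
  then have "continuous_map (subtopology (full_shift (A 0)) (X 0)) euclidean g"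
    by (subst continuous_map_circle_iff[OF level_subshift_range]) auto
  with eigen show ?thesis unfolding continuous_eigenvalue_def by blast
qed

end


locale left_proper_directive = primitive_directive +
  assumes lp: "\<And>n. left_proper (A (n + 1)) (A n) (\<tau> n)"
begin

text \<open>The distinguished letter with which the images of all letters begin.\<close>

definition first :: "nat \<Rightarrow> 'a"
  where "first n = (SOME b. b \<in> A n \<and> (\<forall>a\<in>A (Suc n). prefix [b] (\<tau> n [a])))"

lemma first: "first n \<in> A n \<and> (\<forall>a\<in>A (Suc n). prefix [first n] (\<tau> n [a]))"
  unfolding first_def by (rule someI_ex) (use lp[of n] in \<open>auto simp: left_proper_def\<close>)

lemma first_in_alphabet: "first n \<in> A n"
  using first by blast

lemma prefix_first:
  assumes "n < m" "a \<in> A m"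
  shows "prefix [first n] (comp n m [a])"
proof -
  obtain c v where cv: "comp (Suc n) m [a] = c # v"
    using comp_letter_nonempty[of "Suc n" m a] assms by (cases "comp (Suc n) m [a]") auto
  have "c # v \<in> lists (A (Suc n))"
    unfolding cv[symmetric] using assms by (intro comp_in_lists) auto
  then have "comp n (Suc n) (c # v) = \<tau> n [c] @ comp n (Suc n) v" "c \<in> A (Suc n)"
    using comp_append[of n "Suc n" "[c]" v] by (auto simp: comp_Suc)
  then show ?thesis
    using first[of n] comp_trans[of n "Suc n" m "[a]"] assms(1) cv by (auto simp: prefix_prefix)
qed

lemma prefix_comp_first:
  assumes "n \<le> m" "m < l" "a \<in> A l"
  shows "prefix (comp n m [first m]) (comp n l [a])"
  using substitution_prefix[OF substitution_comp[OF assms(1)] prefix_first[OF assms(2,3)]]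
    comp_in_lists[of m l "[a]"] comp_trans[of n m l "[a]"] assms by simp

lemma common_prefix:
  "\<exists>m. \<forall>n>m. \<exists>p. K \<le> length p \<and> (\<forall>a\<in>A n. prefix p (comp 0 n [a]))"
proof -
  obtain m where m: "\<forall>a\<in>A m. K \<le> length (comp 0 m [a])"
    using images_grow[of 0 K] by blast
  then show ?thesis
    using prefix_comp_first[of 0 m] first_in_alphabet[of m] by blast
qed

text \<open>The image of a point of level \<open>n\<close> starts, at the beginning of any of its blocks, with the same long
  word. Thus the eigenfunction hardly changes between the beginnings of two blocks, while these are
  separated in time by the height of a word, whose multiple by \<open>\<alpha>\<close> is thus close to an integer. Only
  the right halves agree, which suffices after
  moving forward by half of the length of the common word.\<close>

theorem sup_dist_tendsto_0_if_eigenvalue: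
  assumes "continuous_eigenvalue (A 0) (X 0) \<alpha>"
  shows "sup_dist \<alpha> \<longlonglongrightarrow> 0"
proof -
  obtain g where cont: "continuous_map (subtopology (full_shift (A 0)) (X 0)) euclidean g"
      and eigen: "\<And>x. x \<in> X 0 \<Longrightarrow> g (shift_map x) = g x + real_mod_Z \<alpha>"
    using assms by (auto simp: continuous_eigenvalue_def)
  have iter: "g (\<lambda>j. x (j + int k)) = g x + real_mod_Z (\<alpha> * real k)" if x: "x \<in> X 0" for x k
  proof (induction k)
    case 0
    have "real_mod_Z 0 = 0" by transfer simp
    then show ?case by simp
  next
    case (Suc k)
    have "g (\<lambda>j. x (j + int (Suc k))) = g (shift_map (\<lambda>j. x (j + int k)))"
      by (simp add: shift_map_def algebra_simps)
    also have "\<dots> = g (\<lambda>j. x (j + int k)) + real_mod_Z \<alpha>"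
      by (rule eigen) (rule level_subshift_translate[OF x])
    also have "\<dots> = g x + real_mod_Z (\<alpha> * real (Suc k))"
      unfolding Suc by (simp add: algebra_simps real_mod_Z_add)
    finally show ?case .
  qed
  have "\<exists>m. \<forall>n>m. sup_dist \<alpha> n \<le> e" if e: "e > 0" for e
  proof -
    have "\<exists>N. \<forall>x\<in>X 0. \<forall>y\<in>X 0. agree N x y \<longrightarrow> circle_norm (g x - g y) < e"
      by (rule circle_valued_uniform_continuity[OF finite_alphabet level_subshift_range
            level_subshift_closed cont e])
    then obtain N where N: "\<And>x y. x \<in> X 0 \<Longrightarrow> y \<in> X 0 \<Longrightarrow> agree N x y \<Longrightarrow> circle_norm (g x - g y) < e"
      by blast
    \<comment> \<open>agreement on \<open>[0, K)\<close> becomes agreement on \<open>[-N, N]\<close> after \<open>N\<close> steps\<close>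
    define K where "K = 2 * N + 1"
    obtain m where m: "\<And>n. n > m \<Longrightarrow> \<exists>p. K \<le> length p \<and> (\<forall>a\<in>A n. prefix p (comp 0 n [a]))"
      using common_prefix by blast
    have "sup_dist \<alpha> n \<le> e" if n: "n > m" for n
    proof (rule sup_dist_le)
      fix u assume "u \<in> words n"
      then obtain y0 i l where "y0 \<in> X n" "u = factor y0 i l"
        unfolding language_level_subshift[symmetric] by (auto simp: language_def)
      then obtain y where y: "y \<in> X n" "u = factor y 0 l"
        using level_subshift_translate[of y0 n i] factor_translate[of y0 i 0 l] by force
      obtain p where p: "K \<le> length p" "\<And>a. a \<in> A n \<Longrightarrow> prefix p (comp 0 n [a])"
        using m[OF n] by blast
      note s = substitution_comp[of 0 n, simplified]
      define x where "x = subst_point (comp 0 n) y"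
      define h where "h = ht n u"
      have x: "x \<in> X 0" unfolding x_def by (rule subst_point_level_subshift) (use y in auto)
      have start: "subst_point (comp 0 n) z (int t) = p ! t" if z: "z \<in> X n" and t: "t < K" for z t
      proof -
        have pre: "prefix p (comp 0 n [z 0])" by (rule p(2)) (rule level_subshift_letter[OF z])
        then have "t < length (comp 0 n [z 0])" using prefix_length_le[OF pre] p(1) t by simp
        then have "subst_point (comp 0 n) z (block_start (comp 0 n) z 0 + int t) = comp 0 n [z 0] ! t"
          by (rule subst_point_at_block_start[OF s level_subshift_range[OF z]])
        also have "\<dots> = p ! t" using pre p(1) t by (auto elim!: prefixE simp: nth_append)
        finally show ?thesis by (simp add: block_start_0[OF s])
      qed
      have "block_start (comp 0 n) y (int l) = int h"
        using y(2) by (simp add: block_start_def h_def height_def)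
      then have xh: "(\<lambda>j. x (j + int h)) = subst_point (comp 0 n) (\<lambda>j. y (j + int l))"
        using subst_point_translate[OF s level_subshift_range[OF y(1)], of "int l"]
        by (simp add: x_def)
      have same: "x (int t + int h) = x (int t)" if "t < K" for t
        using start[OF y(1) that] start[OF level_subshift_translate[OF y(1), of "int l"] that]
          fun_cong[OF xh, of "int t"] by (simp add: x_def)
      have "agree N (\<lambda>j. x (j + int (N + h))) (\<lambda>j. x (j + int N))"
        unfolding agree_def
      proof (intro allI impI)
        fix j assume "\<bar>j\<bar> \<le> int N"
        then have "nat (j + int N) < K" "int (nat (j + int N)) = j + int N" by (auto simp: K_def)
        then show "x (j + int (N + h)) = x (j + int N)"
          using same[of "nat (j + int N)"] by (simp add: algebra_simps)
      qed
      then have "circle_norm (g (\<lambda>j. x (j + int (N + h))) - g (\<lambda>j. x (j + int N))) < e"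
        using N level_subshift_translate[OF x] by blast
      also have "g (\<lambda>j. x (j + int (N + h))) - g (\<lambda>j. x (j + int N)) = real_mod_Z (\<alpha> * real h)"
        unfolding iter[OF x] by (simp add: algebra_simps real_mod_Z_add)
      finally show "dist_nearest_int (\<alpha> * real (ht n u)) \<le> e"
        by (simp add: h_def)
    qed
    then show ?thesis by blast
  qed
  note bound = this
  show ?thesis
  proof (rule order_tendstoI)
    show "\<forall>\<^sub>F n in sequentially. c < sup_dist \<alpha> n" if "c < 0" for c
      using that sup_dist_nonneg[of \<alpha>] by (simp add: less_le_trans)
    show "\<forall>\<^sub>F n in sequentially. sup_dist \<alpha> n < c" if c: "c > 0" for c
    proof -
      obtain m where m: "\<And>n. n > m \<Longrightarrow> sup_dist \<alpha> n \<le> c / 2" using bound[OF half_gt_zero[OF c]] by blast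
      have "sup_dist \<alpha> n < c" if "n > m" for n
        using m[OF that] c by linarith
      then show ?thesis by (metis eventually_at_top_dense)
    qed
  qed
qed

end


section \<open>The criterion by a series\<close>

lemma prefix_image_decompose:
  assumes s: "substitution A B \<sigma>" and w: "w \<in> lists A" and p: "strict_prefix p (\<sigma> w)"
  shows "\<exists>v c q. prefix (v @ [c]) w \<and> p = \<sigma> v @ q \<and> prefix q (\<sigma> [c])"
  using w p
proof (induction arbitrary: p rule: lists.induct)
  case Nil
  then show ?case by (simp add: substitution_Nil[OF s])
next
  case (Cons a w)
  then have "\<sigma> (a # w) = \<sigma> [a] @ \<sigma> w" using substitution_Cons[OF s, of a w] by simp
  with Cons.prems have "prefix p (\<sigma> [a] @ \<sigma> w)" "p \<noteq> \<sigma> [a] @ \<sigma> w" by auto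
  then consider "prefix p (\<sigma> [a])" | q where "p = \<sigma> [a] @ q" "strict_prefix q (\<sigma> w)"
    by (metis prefix_append strict_prefix_def)
  then show ?case
  proof cases
    case 1
    then show ?thesis
      using substitution_Nil[OF s]
      by (intro exI[of _ "[]"] exI[of _ a] exI[of _ p]) simp
  next
    case 2
    obtain v c r where v: "prefix (v @ [c]) w" "q = \<sigma> v @ r" "prefix r (\<sigma> [c])"
      using Cons.IH[OF 2(2)] by blast
    have "v \<in> lists A" using prefix_in_lists[OF v(1), of A] Cons.hyps by simp
    then have "\<sigma> (a # v) = \<sigma> [a] @ \<sigma> v" using substitution_Cons[OF s, of a v] Cons.hyps by simp
    then show ?thesis
      using v 2(1) by (intro exI[of _ "a # v"] exI[of _ c] exI[of _ r]) simp
  qed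
qed

context directive
begin

abbreviation prefix_dists :: "real \<Rightarrow> nat \<Rightarrow> real set"
  where "prefix_dists \<alpha> n \<equiv> {dist_nearest_int (\<alpha> * real (ht n u)) | a u.
    a \<in> A (n + 2) \<and> prefix u (\<tau> n (\<tau> (n + 1) [a]))}"

lemma comp_2: "comp n (n + 2) u = \<tau> n (\<tau> (n + 1) u)"
  using comp_trans[of n "Suc n" "Suc (Suc n)" u] by (simp add: comp_Suc)

lemma finite_prefix_dists: "finite (prefix_dists \<alpha> n)"
proof -
  define D where "D a = (\<lambda>u. dist_nearest_int (\<alpha> * real (ht n u))) ` set (prefixes (\<tau> n (\<tau> (n + 1) [a])))" for a
  have "prefix_dists \<alpha> n \<subseteq> (\<Union>a\<in>A (n + 2). D a)"
    unfolding D_def in_set_prefixes[symmetric] by blast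
  moreover have "finite (\<Union>a\<in>A (n + 2). D a)" by (simp add: D_def)
  ultimately show ?thesis by (rule finite_subset)
qed

definition max_prefix_dist :: "real \<Rightarrow> nat \<Rightarrow> real"
  where "max_prefix_dist \<alpha> n = Max (prefix_dists \<alpha> n)"

lemma dist_prefix_le_max:
  "a \<in> A (n + 2) \<Longrightarrow> prefix u (comp n (n + 2) [a]) \<Longrightarrow>
    dist_nearest_int (\<alpha> * real (ht n u)) \<le> max_prefix_dist \<alpha> n"
  unfolding comp_2 max_prefix_dist_def by (rule Max_ge[OF finite_prefix_dists]) blast

lemma prefix_dists_attained:
  "\<exists>a\<in>A (n + 2). \<exists>u. prefix u (comp n (n + 2) [a]) \<and>
    max_prefix_dist \<alpha> n = dist_nearest_int (\<alpha> * real (ht n u))"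
proof -
  obtain a where "a \<in> A (n + 2)" using alphabet_nonempty by blast
  then have "prefix_dists \<alpha> n \<noteq> {}" using Nil_prefix by blast
  from Max_in[OF finite_prefix_dists this] show ?thesis unfolding comp_2 max_prefix_dist_def by blast
qed

lemma max_prefix_dist_nonneg: "0 \<le> max_prefix_dist \<alpha> n"
  using prefix_dists_attained[of n \<alpha>] by fastforce

lemma dist_height_diff:
  assumes "u \<in> lists (A n)" "v \<in> lists (A n)"
  shows "dist_nearest_int (\<alpha> * real (ht n v)) \<le>
    dist_nearest_int (\<alpha> * real (ht n (u @ v))) + dist_nearest_int (\<alpha> * real (ht n u))"
proof -
  have "\<alpha> * real (ht n v) = \<alpha> * real (ht n (u @ v)) - \<alpha> * real (ht n u)"
    by (simp add: height_append[OF assms] algebra_simps)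
  then show ?thesis using dist_nearest_int_diff by metis
qed

lemma dist_height_append:
  assumes "u \<in> lists (A n)" "v \<in> lists (A n)"
  shows "dist_nearest_int (\<alpha> * real (ht n (u @ v))) \<le>
    dist_nearest_int (\<alpha> * real (ht n u)) + dist_nearest_int (\<alpha> * real (ht n v))"
proof -
  have "\<alpha> * real (ht n (u @ v)) = \<alpha> * real (ht n u) + \<alpha> * real (ht n v)"
    by (simp add: height_append[OF assms] algebra_simps)
  then show ?thesis using dist_nearest_int_add by metis
qed

text \<open>The letter \<open>c\<close> occurs in the image of some letter of the next level, so a prefix of its image is the
  difference of two prefixes of images two levels up.\<close>

lemma dist_prefix_letter_image:
  assumes c: "c \<in> A (n + 1)" and q: "prefix q (comp n (n + 1) [c])"
  shows "dist_nearest_int (\<alpha> * real (ht n q)) \<le> 2 * max_prefix_dist \<alpha> n"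
proof -
  obtain a where a: "a \<in> A (n + 2)" "sublist [c] (comp (n + 1) (n + 2) [a])"
    using letter_occurs_above[of "n + 1" "n + 2" c] c by auto
  then obtain l r where lr: "comp (n + 1) (n + 2) [a] = l @ [c] @ r" by (auto simp: sublist_def)
  have "l @ [c] @ r \<in> lists (A (n + 1))"
    unfolding lr[symmetric] using a(1) by (intro comp_in_lists) auto
  then have l: "l \<in> lists (A (n + 1))" and r: "r \<in> lists (A (n + 1))" by auto
  have "comp n (n + 2) [a] = comp n (n + 1) l @ comp n (n + 1) [c] @ comp n (n + 1) r"
    using comp_trans[of n "n + 1" "n + 2" "[a]"] lr comp_append[of n "n + 1" l "[c] @ r"]
      comp_append[of n "n + 1" "[c]" r] l r c by simp
  then have "prefix (comp n (n + 1) l) (comp n (n + 2) [a])"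
      "prefix (comp n (n + 1) l @ q) (comp n (n + 2) [a])"
    using q by (auto simp: prefix_prefix)
  then have "dist_nearest_int (\<alpha> * real (ht n (comp n (n + 1) l))) \<le> max_prefix_dist \<alpha> n"
      "dist_nearest_int (\<alpha> * real (ht n (comp n (n + 1) l @ q))) \<le> max_prefix_dist \<alpha> n"
    using dist_prefix_le_max[OF a(1)] by blast+
  moreover have "q \<in> lists (A n)"
    by (rule prefix_in_lists[OF q], rule comp_in_lists) (use c in auto)
  ultimately show ?thesis
    using dist_height_diff[of "comp n (n + 1) l" n q \<alpha>] comp_in_lists[of n "n + 1" l] l by linarith
qed

text \<open>Going down one level at a time, a proper prefix splits into the image of a proper prefix and a prefix of
  the image of a single letter. For an improper prefix, the estimate would already fail at \<open>n = m\<close>.\<close>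

lemma dist_prefix_image_le_sum:
  assumes "n \<le> m" "a \<in> A m" "strict_prefix p (comp n m [a])"
  shows "dist_nearest_int (\<alpha> * real (ht n p)) \<le> 2 * (\<Sum>k=n..<m. max_prefix_dist \<alpha> k)"
  using assms(1,3)
proof (induction n arbitrary: p rule: inc_induct)
  case base
  then have "p = []" by (cases p) (auto simp: strict_prefix_def prefix_Cons)
  then show ?case by simp
next
  case (step n)
  define w where "w = comp (Suc n) m [a]"
  have w: "w \<in> lists (A (Suc n))" unfolding w_def using step.hyps assms(2) by (intro comp_in_lists) auto
  have "strict_prefix p (comp n (Suc n) w)"
    using step.prems comp_trans[of n "Suc n" m "[a]"] step.hyps by (simp add: w_def)
  then obtain v c q where v: "prefix (v @ [c]) w" "p = comp n (Suc n) v @ q"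
      "prefix q (comp n (Suc n) [c])"
    using prefix_image_decompose[OF substitution_comp w, of n p] by auto
  have vc: "v \<in> lists (A (Suc n))" "c \<in> A (Suc n)" using prefix_in_lists[OF v(1) w] by auto
  have "strict_prefix v w" using v(1) by (auto simp: strict_prefix_def elim!: prefixE)
  then have "dist_nearest_int (\<alpha> * real (ht (Suc n) v)) \<le> 2 * (\<Sum>k=Suc n..<m. max_prefix_dist \<alpha> k)"
    unfolding w_def by (rule step.IH)
  moreover have "dist_nearest_int (\<alpha> * real (ht n q)) \<le> 2 * max_prefix_dist \<alpha> n"
    using dist_prefix_letter_image[of c n q \<alpha>] vc v(3) by simp
  moreover have "q \<in> lists (A n)"
    by (rule prefix_in_lists[OF v(3)], rule comp_in_lists) (use vc in auto)
  then have "dist_nearest_int (\<alpha> * real (ht n p)) \<le>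
      dist_nearest_int (\<alpha> * real (ht n (comp n (Suc n) v))) + dist_nearest_int (\<alpha> * real (ht n q))"
    unfolding v(2) by (intro dist_height_append comp_in_lists vc) auto
  ultimately show ?case
    using step.hyps by (simp add: height_comp sum.atLeast_Suc_lessThan)
qed

end

context primitive_directive
begin

text \<open>A word is the difference of two proper prefixes of images, and the bound for these is twice a tail of
  the series.\<close>

theorem sup_dist_tendsto_0_if_summable:
  assumes sm: "summable (max_prefix_dist \<alpha>)"
  shows "sup_dist \<alpha> \<longlonglongrightarrow> 0"
proof -
  let ?d = "max_prefix_dist \<alpha>"
  have "sup_dist \<alpha> n \<le> 4 * (\<Sum>k. ?d (k + n))" for n
  proof (rule sup_dist_le)
    fix u assume u: "u \<in> words n"
    \<comment> \<open>one letter to the right of \<open>u\<close> makes the prefix that ends with \<open>u\<close> a proper one\<close>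
    obtain l r where lr: "length l = 1" "length r = 1" "l @ u @ r \<in> words n"
      using words_extend[OF u, of 1] by blast
    then obtain m a where m: "m \<ge> n" "a \<in> A m" "sublist (l @ u @ r) (comp n m [a])"
      by (auto simp: words_def)
    then obtain l' r' where eq: "comp n m [a] = (l' @ l) @ u @ (r @ r')" (is "_ = ?p @ _ @ _")
      by (auto simp: sublist_def)
    have "?p @ u @ (r @ r') \<in> lists (A n)"
      unfolding eq[symmetric] using m by (intro comp_in_lists) auto
    then have in_lists: "?p \<in> lists (A n)" "u \<in> lists (A n)" by auto
    have "r \<noteq> []" using lr(2) by auto
    then have "strict_prefix ?p (comp n m [a])" "strict_prefix (?p @ u) (comp n m [a])"
      unfolding eq by (auto simp: strict_prefix_def)
    then have "dist_nearest_int (\<alpha> * real (ht n ?p)) \<le> 2 * (\<Sum>k=n..<m. ?d k)"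
        "dist_nearest_int (\<alpha> * real (ht n (?p @ u))) \<le> 2 * (\<Sum>k=n..<m. ?d k)"
      using dist_prefix_image_le_sum[OF m(1,2)] by blast+
    with dist_height_diff[OF in_lists, of \<alpha>]
    have "dist_nearest_int (\<alpha> * real (ht n u)) \<le> 4 * (\<Sum>k=n..<m. ?d k)" by linarith
    also have "(\<Sum>k=n..<m. ?d k) = (\<Sum>k<m-n. ?d (k + n))"
      using sum.atLeastLessThan_shift_0[of ?d n m] by (simp add: lessThan_atLeast0 add.commute)
    also have "\<dots> \<le> (\<Sum>k. ?d (k + n))"
      using sm max_prefix_dist_nonneg by (intro sum_le_suminf) (simp_all add: summable_iff_shift)
    finally show "dist_nearest_int (\<alpha> * real (ht n u)) \<le> 4 * (\<Sum>k. ?d (k + n))" by simp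
  qed
  then have upper: "\<forall>\<^sub>F n in sequentially. sup_dist \<alpha> n \<le> 4 * (\<Sum>k. ?d (k + n))" by simp
  have tail: "(\<lambda>n. 4 * (\<Sum>k. ?d (k + n))) \<longlonglongrightarrow> 0"
    using tendsto_mult_left[OF suminf_exist_split2[OF sm], of 4] by simp
  have lower: "\<forall>\<^sub>F n in sequentially. 0 \<le> sup_dist \<alpha> n" by (simp add: sup_dist_nonneg)
  show ?thesis by (rule tendsto_sandwich[OF lower upper tendsto_const tail])
qed

end


section \<open>Independent choices of prefixes\<close>

lemma dist_nearest_int_eq_abs:
  assumes "\<bar>x\<bar> < 1 / 2"
  shows "dist_nearest_int x = \<bar>x\<bar>"
proof -
  have "round x = 0" by (rule round_unique') (use assms in simp)
  then show ?thesis by (simp add: dist_nearest_int_def)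
qed

text \<open>Adding the terms one at a time, the sum moves to the right in steps of length at most \<open>1 / 8\<close>. So it
  cannot jump over the gap between \<open>1 / 8\<close> and \<open>7 / 8\<close>, where the distance to the integers would be too
  large.\<close>

lemma sum_le_if_subset_sums_near_int:
  fixes s :: "'i \<Rightarrow> real"
  assumes "finite F" "\<And>k. k \<in> F \<Longrightarrow> 0 \<le> s k \<and> s k \<le> 1 / 8"
    "\<And>G. G \<subseteq> F \<Longrightarrow> dist_nearest_int (sum s G) \<le> 1 / 8"
  shows "sum s F \<le> 1 / 8"
  using assms
proof (induction F rule: finite_induct)
  case (insert k F)
  have "sum s F \<le> 1 / 8" by (rule insert.IH) (use insert.prems in auto)
  moreover have "0 \<le> sum s F" by (rule sum_nonneg) (use insert.prems in auto)
  ultimately have "0 \<le> sum s (insert k F)" "sum s (insert k F) \<le> 1 / 4"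
    using insert.hyps insert.prems(1)[of k] by auto
  then show ?case
    using dist_nearest_int_eq_abs[of "sum s (insert k F)"] insert.prems(2)[of "insert k F"] by simp
qed simp

text \<open>Modulo integers, each \<open>t k\<close> is its signed distance \<open>s k\<close> to the nearest integer. The preceding lemma
  bounds the sums of the positive and of the negative ones.\<close>

lemma sum_dist_le_if_subset_sums_near_int:
  fixes t :: "'i \<Rightarrow> real"
  assumes F: "finite F" and sub: "\<And>G. G \<subseteq> F \<Longrightarrow> dist_nearest_int (sum t G) \<le> 1 / 8"
  shows "(\<Sum>k\<in>F. dist_nearest_int (t k)) \<le> 1 / 4"
proof -
  define s where "s k = t k - of_int (round (t k))" for k
  have abs_s: "\<bar>s k\<bar> = dist_nearest_int (t k)" for k
    by (simp add: s_def dist_nearest_int_def)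
  have s_le: "\<bar>s k\<bar> \<le> 1 / 8" if "k \<in> F" for k
    using sub[of "{k}"] that by (simp add: abs_s)
  have s_sub: "dist_nearest_int (sum s G) \<le> 1 / 8" if "G \<subseteq> F" for G
  proof -
    have "sum t G - sum s G = of_int (\<Sum>k\<in>G. round (t k))"
      by (simp add: s_def sum_subtractf)
    then have "dist_nearest_int (sum t G) = dist_nearest_int (sum s G)"
      by (intro dist_nearest_int_cong_Ints) (metis Ints_of_int)
    then show ?thesis using sub[OF that] by simp
  qed
  define P where "P = {k\<in>F. 0 \<le> s k}"
  define M where "M = {k\<in>F. \<not> 0 \<le> s k}"
  have "sum s P \<le> 1 / 8"
  proof (rule sum_le_if_subset_sums_near_int)
    show "0 \<le> s k \<and> s k \<le> 1 / 8" if "k \<in> P" for k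
      using s_le[of k] that by (simp add: P_def)
    show "dist_nearest_int (sum s G) \<le> 1 / 8" if "G \<subseteq> P" for G
      using s_sub[of G] that by (auto simp: P_def)
  qed (use F in \<open>simp add: P_def\<close>)
  moreover have "sum (\<lambda>k. - s k) M \<le> 1 / 8"
  proof (rule sum_le_if_subset_sums_near_int)
    show "dist_nearest_int (\<Sum>k\<in>G. - s k) \<le> 1 / 8" if "G \<subseteq> M" for G
      using s_sub[of G] that by (auto simp: M_def sum_negf)
    show "0 \<le> - s k \<and> - s k \<le> 1 / 8" if "k \<in> M" for k
      using s_le[of k] that by (simp add: M_def)
  qed (use F in \<open>simp add: M_def\<close>)
  moreover have "(\<Sum>k\<in>F. dist_nearest_int (t k)) = sum s P + sum (\<lambda>k. - s k) M"
  proof -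
    have "(\<Sum>k\<in>F. dist_nearest_int (t k)) = (\<Sum>k\<in>P \<union> M. \<bar>s k\<bar>)"
      by (rule sum.cong) (auto simp: abs_s P_def M_def)
    also have "\<dots> = (\<Sum>k\<in>P. \<bar>s k\<bar>) + (\<Sum>k\<in>M. \<bar>s k\<bar>)"
      by (rule sum.union_disjoint) (use F in \<open>auto simp: P_def M_def\<close>)
    also have "(\<Sum>k\<in>P. \<bar>s k\<bar>) = sum s P" by (rule sum.cong) (auto simp: P_def)
    also have "(\<Sum>k\<in>M. \<bar>s k\<bar>) = sum (\<lambda>k. - s k) M" by (rule sum.cong) (auto simp: M_def)
    finally show ?thesis .
  qed
  ultimately show ?thesis by linarith
qed

lemma summable_if_summable_residue_classes:
  fixes f :: "nat \<Rightarrow> real"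
  assumes p: "p > 0" and nonneg: "\<And>n. 0 \<le> f n"
    and sm: "\<And>r. r < p \<Longrightarrow> summable (\<lambda>j. f (r + j * p))"
  shows "summable f"
proof (rule bounded_imp_summable)
  fix n
  have "{..n} \<subseteq> {..<Suc n * p}"
  proof
    fix k assume "k \<in> {..n}"
    then have "k < Suc n * 1" by simp
    also have "\<dots> \<le> Suc n * p" using p by (intro mult_le_mono2) simp
    finally show "k \<in> {..<Suc n * p}" by simp
  qed
  then have "sum f {..n} \<le> sum f {..<Suc n * p}"
    by (intro sum_mono2) (auto simp: nonneg)
  also have "\<dots> = (\<Sum>j<Suc n. sum f {j * p..<j * p + p})"
    by (rule sum.nat_group[symmetric])
  also have "\<dots> = (\<Sum>j<Suc n. \<Sum>r<p. f (r + j * p))"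
  proof (rule sum.cong[OF refl])
    fix j
    show "sum f {j * p..<j * p + p} = (\<Sum>r<p. f (r + j * p))"
      using sum.atLeastLessThan_shift_0[of f "j * p" "j * p + p"]
      by (simp add: lessThan_atLeast0 add.commute)
  qed
  also have "\<dots> = (\<Sum>r<p. \<Sum>j<Suc n. f (r + j * p))" by (rule sum.swap)
  also have "\<dots> \<le> (\<Sum>r<p. \<Sum>j. f (r + j * p))"
    by (intro sum_mono sum_le_suminf sm) (auto simp: nonneg)
  finally show "sum f {..n} \<le> (\<Sum>r<p. \<Sum>j. f (r + j * p))" .
qed (rule nonneg)

context left_proper_directive
begin

text \<open>At levels that are five apart, proper prefixes of images of the distinguished letters four levels up
  can be chosen independently of each other. As the prefix is proper, a letter follows it. Whichever
  letter this is, its image begins with the distinguished letter of the level below, which is the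
  one from which the next choice is made.\<close>

lemma stack_prefixes:
  assumes v: "\<And>j. strict_prefix (v j) (comp (r + j * 5) (r + j * 5 + 4) [first (r + j * 5 + 4)])"
    and "I \<le> J"
  shows "\<exists>W. strict_prefix W (comp (r + I * 5) (r + J * 5) [first (r + J * 5)])
    \<and> ht (r + I * 5) W = (\<Sum>j=I..<J. ht (r + j * 5) (v j))"
  using \<open>I \<le> J\<close>
proof (induction I rule: inc_induct)
  case base
  show ?case by (intro exI[of _ "[]"]) simp
next
  case (step i)
  define n where "n = r + i * 5"
  define m where "m = r + J * 5"
  have m: "n + 5 \<le> m" using step.hyps by (simp add: n_def m_def)
  obtain W where W: "strict_prefix W (comp (n + 5) m [first m])"
      "ht (n + 5) W = (\<Sum>j=Suc i..<J. ht (r + j * 5) (v j))"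
    using step.IH by (auto simp: n_def m_def algebra_simps)
  obtain d z where dz: "comp (n + 5) m [first m] = W @ d # z"
    using W(1) by (auto simp: strict_prefix_def elim!: prefixE) (metis append_Nil2 list.exhaust)
  have "W @ d # z \<in> lists (A (n + 5))"
    unfolding dz[symmetric] using m first_in_alphabet[of m] by (intro comp_in_lists) auto
  then have in_lists: "W \<in> lists (A (n + 5))" "d \<in> A (n + 5)" "z \<in> lists (A (n + 5))" by auto
  have full: "comp n m [first m] = comp n (n + 5) W @ comp n (n + 5) [d] @ comp n (n + 5) z"
    using comp_trans[of n "n + 5" m "[first m]"] m dz comp_append[of n "n + 5" W "d # z"]
      comp_append[of n "n + 5" "[d]" z] in_lists by simp
  have vi: "strict_prefix (v i) (comp n (n + 4) [first (n + 4)])"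
    using v[of i] by (simp add: n_def)
  have "prefix (comp n (n + 4) [first (n + 4)]) (comp n (n + 5) [d])"
    by (rule prefix_comp_first) (use in_lists in auto)
  with vi have vd: "strict_prefix (v i) (comp n (n + 5) [d])"
    by (rule prefix_order.less_le_trans)
  have "v i \<in> lists (A n)"
    by (rule prefix_in_lists[OF prefix_order.less_imp_le[OF vd]], rule comp_in_lists) (use in_lists in auto)
  then have "ht n (comp n (n + 5) W @ v i) = ht (n + 5) W + ht n (v i)"
    using height_append[of "comp n (n + 5) W" n "v i"] comp_in_lists[of n "n + 5" W] in_lists(1)
      height_comp[of n "n + 5" W] by simp
  also have "\<dots> = (\<Sum>j=i..<J. ht (r + j * 5) (v j))"
    using step.hyps W(2) by (simp add: sum.atLeast_Suc_lessThan n_def)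
  finally have "ht n (comp n (n + 5) W @ v i) = (\<Sum>j=i..<J. ht (r + j * 5) (v j))" .
  moreover have "strict_prefix (comp n (n + 5) W @ v i) (comp n m [first m])"
    unfolding full using vd by (auto simp: strict_prefix_def prefix_prefix) 
  ultimately show ?case unfolding n_def m_def by blast
qed

text \<open>By the preceding lemma, all subset sums of the chosen heights are heights of words, so they are close to
  integers after multiplication by \<open>\<alpha>\<close>. This bounds the sum of the distances.\<close>

lemma summable_dist_prefixes:
  assumes lim: "sup_dist \<alpha> \<longlonglongrightarrow> 0"
    and v: "\<And>n. strict_prefix (v n) (comp n (n + 4) [first (n + 4)])"
  shows "summable (\<lambda>n. dist_nearest_int (\<alpha> * real (ht n (v n))))"
proof (rule summable_if_summable_residue_classes)
  show "(0::nat) < 5" by simp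
  fix r :: nat
  define t where "t j = \<alpha> * real (ht (r + j * 5) (v (r + j * 5)))" for j
  have "\<forall>\<^sub>F n in sequentially. sup_dist \<alpha> n < 1 / 8"
    by (rule order_tendstoD(2)[OF lim]) simp
  then obtain I where I: "\<And>n. n \<ge> I \<Longrightarrow> sup_dist \<alpha> n < 1 / 8"
    unfolding eventually_sequentially by blast
  have bound: "(\<Sum>j=I..<J. dist_nearest_int (t j)) \<le> 1 / 4" if J: "I \<le> J" for J
  proof (rule sum_dist_le_if_subset_sums_near_int)
    fix G assume G: "G \<subseteq> {I..<J}"
    define v' where "v' j = (if j \<in> G then v (r + j * 5) else [])" for j
    have "strict_prefix (v' j) (comp (r + j * 5) (r + j * 5 + 4) [first (r + j * 5 + 4)])" for j
      using v[of "r + j * 5"] by (auto simp: v'_def strict_prefix_def)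
    from stack_prefixes[OF this J]
    obtain W where W: "strict_prefix W (comp (r + I * 5) (r + J * 5) [first (r + J * 5)])"
        "ht (r + I * 5) W = (\<Sum>j=I..<J. ht (r + j * 5) (v' j))" by blast
    have "W \<in> words (r + I * 5)"
      by (rule wordsI[of _ "r + J * 5" "first (r + J * 5)"])
        (use W(1) J first_in_alphabet in \<open>auto simp: strict_prefix_def\<close>)
    then have "dist_nearest_int (\<alpha> * real (ht (r + I * 5) W)) \<le> 1 / 8"
      using dist_le_sup_dist[of W "r + I * 5" \<alpha>] I[of "r + I * 5"] by simp
    also have "\<alpha> * real (ht (r + I * 5) W) = sum t G"
    proof -
      have "\<alpha> * real (ht (r + I * 5) W) = (\<Sum>j=I..<J. if j \<in> G then t j else 0)"
        unfolding W(2) of_nat_sum sum_distrib_left by (rule sum.cong) (auto simp: v'_def t_def)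
      also have "\<dots> = sum t ({I..<J} \<inter> G)" by (simp add: sum.inter_restrict)
      also have "{I..<J} \<inter> G = G" using G by blast
      finally show ?thesis .
    qed
    finally show "dist_nearest_int (sum t G) \<le> 1 / 8" .
  qed simp
  have "summable (\<lambda>j. dist_nearest_int (t (j + I)))"
  proof (rule bounded_imp_summable)
    fix n
    have "(\<Sum>j\<le>n. dist_nearest_int (t (j + I))) = (\<Sum>j=I..<I + Suc n. dist_nearest_int (t j))"
      using sum.atLeastLessThan_shift_0[of "\<lambda>j. dist_nearest_int (t j)" I "I + Suc n"]
      by (simp add: lessThan_Suc_atMost[symmetric] lessThan_atLeast0 add.commute del: sum.lessThan_Suc)
    also have "\<dots> \<le> 1 / 4" by (rule bound) simp
    finally show "(\<Sum>j\<le>n. dist_nearest_int (t (j + I))) \<le> 1 / 4" .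
  qed simp
  then show "summable (\<lambda>j. dist_nearest_int (\<alpha> * real (ht (r + j * 5) (v (r + j * 5)))))"
    unfolding t_def[symmetric] using summable_iff_shift[of "\<lambda>j. dist_nearest_int (t j)" I] by simp
qed simp

text \<open>Positivity puts the letter \<open>a\<close> that attains the maximum at level \<open>n\<close> into the image of a distinguished
  letter. So the maximal prefix is a difference of two prefixes to which the preceding lemma applies.
  One more level is needed to make these prefixes proper.\<close>

lemma maximal_prefix_as_difference:
  assumes pos: "positive_sequence A \<tau>"
  shows "\<exists>v w. strict_prefix v (comp n (n + 4) [first (n + 4)])
    \<and> strict_prefix w (comp n (n + 4) [first (n + 4)])
    \<and> max_prefix_dist \<alpha> n \<le> dist_nearest_int (\<alpha> * real (ht n v)) + dist_nearest_int (\<alpha> * real (ht n w))"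
proof -
  have pos': "b \<in> set (comp k (k + 1) [a])" if "a \<in> A (k + 1)" "b \<in> A k" for k a b
    using pos that unfolding positive_sequence_def by blast
  obtain a u where a: "a \<in> A (n + 2)" "prefix u (comp n (n + 2) [a])"
      "max_prefix_dist \<alpha> n = dist_nearest_int (\<alpha> * real (ht n u))"
    using prefix_dists_attained[of n \<alpha>] by blast
  define b where "b = first (n + 3)"
  define c where "c = first (n + 4)"
  have b: "b \<in> A (n + 3)" and c: "c \<in> A (n + 4)"
    by (simp_all add: b_def c_def first_in_alphabet)
  obtain q q' where q: "comp (n + 2) (n + 3) [b] = q @ a # q'"
    using pos'[of b "n + 2" a] b a(1) by (auto simp: numeral_3_eq_3 dest!: split_list)
  obtain r where r: "comp (n + 3) (n + 4) [c] = b # r"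
    using prefix_first[of "n + 3" "n + 4" c] c by (auto simp: b_def elim!: prefixE)
  have r_ne: "r \<noteq> []"
  proof
    assume "r = []"
    then have "A (n + 3) \<subseteq> {b}"
      using pos'[of c "n + 3"] c r by (auto simp: numeral_eq_Suc)
    then have "card (A (n + 3)) \<le> card {b}" by (rule card_mono[rotated]) simp
    then show False using card_alphabet[of "n + 3"] by simp
  qed
  have "q @ a # q' \<in> lists (A (n + 2))"
    unfolding q[symmetric] by (rule comp_in_lists) (use b in auto)
  then have q_lists: "q \<in> lists (A (n + 2))" "q' \<in> lists (A (n + 2))" by auto
  have "b # r \<in> lists (A (n + 3))"
    unfolding r[symmetric] by (rule comp_in_lists) (use c in auto)
  then have r_lists: "r \<in> lists (A (n + 3))" by auto
  define v where "v = comp n (n + 2) q"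
  have "comp n (n + 3) [b] = v @ comp n (n + 2) [a] @ comp n (n + 2) q'"
    using comp_trans[of n "n + 2" "n + 3" "[b]"] q comp_append[of n "n + 2" q "a # q'"]
      comp_append[of n "n + 2" "[a]" q'] q_lists a(1) by (simp add: v_def)
  moreover have "comp n (n + 4) [c] = comp n (n + 3) [b] @ comp n (n + 3) r"
    using comp_trans[of n "n + 3" "n + 4" "[c]"] r comp_append[of n "n + 3" "[b]" r] r_lists b by simp
  ultimately have full: "comp n (n + 4) [c] =
      v @ comp n (n + 2) [a] @ comp n (n + 2) q' @ comp n (n + 3) r" by simp
  have "comp n (n + 3) r \<noteq> []"
    using comp_length_ge[of n "n + 3" r] r_lists r_ne by (auto simp: Suc_le_eq)
  then have "strict_prefix v (comp n (n + 4) [c])" "strict_prefix (v @ u) (comp n (n + 4) [c])"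
    unfolding full using a(2) by (auto simp: strict_prefix_def elim!: prefixE)
  moreover have "v \<in> lists (A n)" "u \<in> lists (A n)"
    using comp_in_lists[of n "n + 2" q] q_lists prefix_in_lists[OF a(2)] comp_in_lists[of n "n + 2" "[a]"] a(1)
    by (auto simp: v_def)
  then have "max_prefix_dist \<alpha> n \<le> dist_nearest_int (\<alpha> * real (ht n v)) + dist_nearest_int (\<alpha> * real (ht n (v @ u)))"
    unfolding a(3) using dist_height_diff[of v n u \<alpha>] by linarith
  ultimately show ?thesis unfolding c_def by blast
qed

theorem summable_if_sup_dist_tendsto_0:
  assumes "positive_sequence A \<tau>" and lim: "sup_dist \<alpha> \<longlonglongrightarrow> 0"
  shows "summable (max_prefix_dist \<alpha>)"
proof -
  define P where "P n v w \<longleftrightarrow> strict_prefix v (comp n (n + 4) [first (n + 4)])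
    \<and> strict_prefix w (comp n (n + 4) [first (n + 4)])
    \<and> max_prefix_dist \<alpha> n \<le> dist_nearest_int (\<alpha> * real (ht n v)) + dist_nearest_int (\<alpha> * real (ht n w))"
    for n v w
  have "\<exists>v w. P n v w" for n
    unfolding P_def by (rule maximal_prefix_as_difference[OF assms(1)])
  then obtain v w where P: "\<And>n. P n (v n) (w n)" by metis
  have v: "strict_prefix (v n) (comp n (n + 4) [first (n + 4)])"
    and w: "strict_prefix (w n) (comp n (n + 4) [first (n + 4)])"
    and le: "max_prefix_dist \<alpha> n \<le>
      dist_nearest_int (\<alpha> * real (ht n (v n))) + dist_nearest_int (\<alpha> * real (ht n (w n)))" for n
    using P[of n] by (simp_all add: P_def)
  have "summable (\<lambda>n. dist_nearest_int (\<alpha> * real (ht n (v n))) + dist_nearest_int (\<alpha> * real (ht n (w n))))"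
    by (intro summable_add summable_dist_prefixes[OF lim] v w)
  then show ?thesis
    by (rule summable_comparison_test'[where N = 0]) (use le max_prefix_dist_nonneg in simp)
qed

end


theorem theorem4p3:
  fixes A :: "nat \<Rightarrow> 'a set"
    and \<tau> :: "nat \<Rightarrow> 'a list \<Rightarrow> 'a list"
    and \<alpha> :: real
  assumes "directive_sequence A \<tau>"
    and "recognizable A \<tau>"
    and "primitive_sequence A \<tau>"
    and "\<And>n. left_proper (A (n + 1)) (A n) (\<tau> n)"
  shows "(continuous_eigenvalue (A 0) (level_subshift A \<tau> 0) \<alpha> \<longleftrightarrow>
            (\<lambda>n. SUP u\<in>language (level_subshift A \<tau> n).
                   dist_nearest_int (\<alpha> * real (height \<tau> n u))) \<longlonglongrightarrow> 0) \<and>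
         (positive_sequence A \<tau> \<longrightarrow>
           (continuous_eigenvalue (A 0) (level_subshift A \<tau> 0) \<alpha> \<longleftrightarrow>
            summable (\<lambda>n. Max {dist_nearest_int (\<alpha> * real (height \<tau> n u)) | a u.
                   a \<in> A (n + 2) \<and> prefix u (\<tau> n (\<tau> (n + 1) [a]))})))"
proof -
  interpret left_proper_directive A \<tau> by unfold_locales (fact assms)+
  interpret recognizable_directive A \<tau> by unfold_locales (fact assms)
  have criterion: "continuous_eigenvalue (A 0) (X 0) \<alpha> \<longleftrightarrow> sup_dist \<alpha> \<longlonglongrightarrow> 0"
    using eigenvalue_if_sup_dist_tendsto_0 sup_dist_tendsto_0_if_eigenvalue by blast
  moreover have "sup_dist \<alpha> \<longlonglongrightarrow> 0 \<longleftrightarrow> summable (max_prefix_dist \<alpha>)" if "positive_sequence A \<tau>"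
    using summable_if_sup_dist_tendsto_0[OF that] sup_dist_tendsto_0_if_summable by blast
  moreover have "sup_dist \<alpha> = (\<lambda>n. SUP u\<in>language (X n). dist_nearest_int (\<alpha> * real (ht n u)))"
    by (simp add: sup_dist_def language_level_subshift fun_eq_iff)
  moreover have "max_prefix_dist \<alpha> = (\<lambda>n. Max (prefix_dists \<alpha> n))"
    by (simp add: max_prefix_dist_def fun_eq_iff)
  ultimately show ?thesis by simp
qed

end
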